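(* Let $a$ be a nonzero rational number and let $p,q$ be rational numbers with $p^2+q^2\neq0$. (1) Let $\mathcal{A}$ be the set of nonzero rational $a$ for which $x^4+ax^2+ax+1$ is divisible by some $x^2+px+q$ with $p,q\in\mathbb{Q}$. Then $\mathcal{A}$ is infinite; more precisely, $\mathcal{A}$ is parameterized by the rational points on the elliptic curve \[E_1:\ Y^2=X^3+4X^2+16X+64,\] which has rank one. (2) The polynomial $x^4+ax^3+ax+1$ is divisible by $x^2+px+q$ if and only if $p\neq 0$, $q=1$ and $a=\frac{p^2-2}{p}$. In this case \[x^4+\tfrac{p^2-2}{p}x^3+\tfrac{p^2-2}{p}x+1=(x^2+px+1)\Big(x^2-\frac{2}{p}x+1\Big).\]
   Context: All polynomials are in $\mathbb{Q}[x]$; divisibility is in $\mathbb{Q}[x]$. *)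

theory Defs
  imports
    "HOL-Computational_Algebra.Polynomial"
    "HOL-Algebra.Free_Abelian_Groups"
begin

section \<open>Elliptic curves \<open>y\<^sup>2 = x\<^sup>3 + a x\<^sup>2 + b x + c\<close> over the rationals\<close>

datatype ec_point = Infinity | Affine rat rat

text \<open>The condition below is that the discriminant of the cubic is nonzero.\<close>

definition is_elliptic_curve :: "rat \<Rightarrow> rat \<Rightarrow> rat \<Rightarrow> bool" where
  "is_elliptic_curve a b c \<longleftrightarrow>
     a\<^sup>2 * b\<^sup>2 - 4 * b ^ 3 - 4 * a ^ 3 * c - 27 * c\<^sup>2 + 18 * a * b * c \<noteq> 0"

definition ec_points :: "rat \<Rightarrow> rat \<Rightarrow> rat \<Rightarrow> ec_point set" where
  "ec_points a b c =
     {Infinity} \<union> {Affine x y | x y. y\<^sup>2 = x ^ 3 + a * x\<^sup>2 + b * x + c}"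

text \<open>
  The chord-and-tangent law. In the last branch \<open>l\<close> is the slope of the chord, or, when
  \<open>x1 = x2\<close> (so that on the curve \<open>y1 = y2 \<noteq> 0\<close>), of the tangent.
\<close>

definition ec_add :: "rat \<Rightarrow> rat \<Rightarrow> rat \<Rightarrow> ec_point \<Rightarrow> ec_point \<Rightarrow> ec_point" where
  "ec_add a b c P Q =
     (case P of
        Infinity \<Rightarrow> Q
      | Affine x1 y1 \<Rightarrow>
          (case Q of
             Infinity \<Rightarrow> P
           | Affine x2 y2 \<Rightarrow>
               if x1 = x2 \<and> y1 = - y2 then Infinity
               else
                 let l = (if x1 = x2 then (3 * x1\<^sup>2 + 2 * a * x1 + b) / (2 * y1)
                          else (y2 - y1) / (x2 - x1));
                     x3 = l\<^sup>2 - a - x1 - x2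
                 in Affine x3 (l * (x1 - x3) - y1)))"

definition ec_group :: "rat \<Rightarrow> rat \<Rightarrow> rat \<Rightarrow> ec_point monoid" where
  "ec_group a b c = \<lparr>carrier = ec_points a b c, mult = ec_add a b c, one = Infinity\<rparr>"

definition torsion_elements :: "('a, 'b) monoid_scheme \<Rightarrow> 'a set" where
  "torsion_elements G = {x \<in> carrier G. \<exists>n::nat. n > 0 \<and> x [^]\<^bsub>G\<^esub> n = \<one>\<^bsub>G\<^esub>}"

text \<open>
  The Mordell--Weil rank: the number \<open>r\<close> in \<open>E(\<rat>) \<cong> \<int>\<^sup>r \<times> E(\<rat>)\<^sub>t\<^sub>o\<^sub>r\<^sub>s\<close> with finite torsion.
\<close>

definition has_rank :: "('a, 'b) monoid_scheme \<Rightarrow> nat \<Rightarrow> bool" where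
  "has_rank G r \<longleftrightarrow>
     comm_group G \<and> finite (torsion_elements G) \<and>
     G \<cong> free_Abelian_group {..<r} \<times>\<times> (G\<lparr>carrier := torsion_elements G\<rparr>)"

section \<open>Quadratic factors of \<open>x\<^sup>4 + a x\<^sup>2 + a x + 1\<close>\<close>

definition quad_factors :: "(rat \<times> rat \<times> rat) set" where
  "quad_factors = {(a, p, q). a \<noteq> 0 \<and> [:q, p, 1:] dvd [:1, a, a, 0, 1:]}"

definition A_set :: "rat set" where
  "A_set = {a. a \<noteq> 0 \<and> (\<exists>p q. [:q, p, 1:] dvd [:1, a, a, 0, 1:])}"

text \<open>
  Comparing coefficients in \<open>(x\<^sup>2 + p x + q) (x\<^sup>2 - p x + 1/q)\<close> gives
  \<open>a = q + 1/q - p\<^sup>2 = p/q - p q\<close>, so \<open>v\<^sup>2 = q\<^sup>4 + 4 q\<^sup>3 - 2 q\<^sup>2 + 4 q + 1\<close> with \<open>v = 2 p q + 1 - q\<^sup>2\<close>.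
  This quartic is carried to \<open>Y\<^sup>2 = X\<^sup>3 + 4 X\<^sup>2 + 16 X + 64\<close> by
  \<open>X = 2 (v + q\<^sup>2 + 2 q - 1) = 4 q (p + 1)\<close> and \<open>Y = 2 (q + 1) (X - 4) + 16 = 8 p (p q + q + 1)\<close>;
  solving for \<open>q\<close> and \<open>p\<close> gives the inverse.
\<close>

definition E1_point :: "rat \<times> rat \<times> rat \<Rightarrow> ec_point" where
  "E1_point = (\<lambda>(a, p, q). Affine (4 * q * (p + 1)) (8 * p * (p * q + q + 1)))"

definition E1_q :: "rat \<Rightarrow> rat \<Rightarrow> rat" where
  "E1_q X Y = (Y - 2 * X - 8) / (2 * (X - 4))"

definition E1_p :: "rat \<Rightarrow> rat \<Rightarrow> rat" where
  "E1_p X Y = X * (X - 4) / (2 * (Y - 2 * X - 8)) - 1"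

definition E1_a :: "rat \<Rightarrow> rat \<Rightarrow> rat" where
  "E1_a X Y = E1_q X Y + 1 / E1_q X Y - (E1_p X Y)\<^sup>2"

end

theory Submission
  imports Defs "HOL-Computational_Algebra.Nth_Powers"
begin

text \<open>
  With \<open>t = 2 Y / (X\<^sup>2 + 16)\<close> and \<open>v = (X\<^sup>2 + 8 X - 16) / (X\<^sup>2 + 16)\<close> the curve \<open>E\<^sub>1\<close> becomes the Jacobi quartic
  \<open>v\<^sup>2 = 1 + 4 t\<^sup>2 - 4 t\<^sup>4\<close>. Its addition law has the denominator \<open>1 + 4 t\<^sub>1\<^sup>2 t\<^sub>2\<^sup>2\<close>, which never vanishes, so the
  group axioms are polynomial identities without case distinctions.

  Let \<open>t = s/e\<close> in lowest terms. If \<open>s\<close> is even, two factorizations into coprime fourth powers show that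
  the point is \<open>2 R\<close> or \<open>- 2 R + (0, -1)\<close>, where the denominator \<open>f\<close> of \<open>R\<close> satisfies \<open>f\<^sup>4 \<le> e\<close>. Adding
  \<open>(1, -1)\<close> flips the parity of \<open>s\<close> and replaces \<open>e\<close> by at most \<open>6 e\<^sup>2\<close>. Hence infinite descent on \<open>e\<close>
  proves that \<open>(1, -1)\<close> and the point \<open>(0, -1)\<close> of order two generate the group. The parity of \<open>s\<close> also
  shows that \<open>(1, -1)\<close> has infinite order, so the rank is one.
\<close>

section \<open>The group of rational points on \<open>v\<^sup>2 = 1 + 4 t\<^sup>2 - 4 t\<^sup>4\<close>\<close>

definition quartic_points :: "(rat \<times> rat) set" where
  "quartic_points = {(t, v). v\<^sup>2 = 1 + 4 * t\<^sup>2 - 4 * t ^ 4}"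

text \<open>The case \<open>e = -4\<close>, \<open>d = -2\<close> of the known addition law on the
  Jacobi quartic \<open>v^2 = e t^4 - 2 d t^2 + 1\<close>.\<close>

fun quartic_add :: "rat \<times> rat \<Rightarrow> rat \<times> rat \<Rightarrow> rat \<times> rat" where
  "quartic_add (t1, v1) (t2, v2) =
     ((t1 * v2 + v1 * t2) / (1 + 4 * t1\<^sup>2 * t2\<^sup>2),
      ((1 - 4 * t1\<^sup>2 * t2\<^sup>2) * (v1 * v2 + 4 * t1 * t2) - 8 * t1 * t2 * (t1\<^sup>2 + t2\<^sup>2))
        / (1 + 4 * t1\<^sup>2 * t2\<^sup>2)\<^sup>2)"

definition quartic_group :: "(rat \<times> rat) monoid" where
  "quartic_group = \<lparr>carrier = quartic_points, mult = quartic_add, one = (0, 1)\<rparr>"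

lemma quartic_group_simps [simp]:
  "carrier quartic_group = quartic_points"
  "x \<otimes>\<^bsub>quartic_group\<^esub> y = quartic_add x y"
  "\<one>\<^bsub>quartic_group\<^esub> = (0, 1)"
  by (simp_all add: quartic_group_def)

lemma quartic_points_iff: "(t, v) \<in> quartic_points \<longleftrightarrow> v\<^sup>2 = 1 + 4 * t\<^sup>2 - 4 * t ^ 4"
  by (simp add: quartic_points_def)

lemma quartic_denom_pos: "1 + 4 * t1\<^sup>2 * t2\<^sup>2 > (0 :: rat)"
  by (simp add: add_pos_nonneg)

lemma quartic_add_closed:
  assumes "P \<in> quartic_points" "Q \<in> quartic_points"
  shows "quartic_add P Q \<in> quartic_points"
proof -
  obtain t1 v1 t2 v2 where PQ: "P = (t1, v1)" "Q = (t2, v2)" by fastforce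
  define D where "D = 1 + 4 * t1\<^sup>2 * t2\<^sup>2"
  define N where "N = t1 * v2 + v1 * t2"
  define M where "M = (1 - 4 * t1\<^sup>2 * t2\<^sup>2) * (v1 * v2 + 4 * t1 * t2) - 8 * t1 * t2 * (t1\<^sup>2 + t2\<^sup>2)"
  have "v1\<^sup>2 = 1 + 4 * t1\<^sup>2 - 4 * t1 ^ 4" "v2\<^sup>2 = 1 + 4 * t2\<^sup>2 - 4 * t2 ^ 4"
    using assms by (simp_all add: PQ quartic_points_iff)
  \<comment> \<open>This is the claim multiplied by \<open>D ^ 4\<close>, a polynomial identity
    modulo the two curve equations.\<close>
  then have M: "M\<^sup>2 = D ^ 4 + 4 * N\<^sup>2 * D\<^sup>2 - 4 * N ^ 4"
    unfolding D_def N_def M_def by algebra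
  have D: "D \<noteq> 0"
    using quartic_denom_pos[of t1 t2] by (simp add: D_def)
  have "(M / D\<^sup>2)\<^sup>2 = M\<^sup>2 / D ^ 4"
    by (simp add: power_divide flip: power_mult)
  also have "\<dots> = 1 + 4 * (N / D)\<^sup>2 - 4 * (N / D) ^ 4"
    unfolding M using D by (simp add: field_simps eval_nat_numeral)
  finally show ?thesis
    by (simp add: PQ quartic_points_iff D_def N_def M_def)
qed

lemma quartic_add_commute: "quartic_add P Q = quartic_add Q P"
  by (cases P; cases Q) (simp add: algebra_simps)

lemma quartic_add_zero [simp]: "quartic_add (0, 1) P = P" "quartic_add P (0, 1) = P"
  by (cases P; simp)+

text \<open>Negation changes the sign of \<open>t\<close> only. Modulo the curve equation the
  numerator of the second coordinate becomes \<open>(1 + 4 t^4)^2\<close>, the square of the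
  denominator.\<close>

lemma quartic_add_neg:
  assumes "(t, v) \<in> quartic_points"
  shows "quartic_add (t, v) (-t, v) = (0, 1)"
proof -
  have "v\<^sup>2 = 1 + 4 * t\<^sup>2 - 4 * t ^ 4"
    using assms by (simp add: quartic_points_iff)
  then have "(1 - 4 * t\<^sup>2 * t\<^sup>2) * (v * v - 4 * t * t) + 8 * t * t * (t\<^sup>2 + t\<^sup>2) = (1 + 4 * t\<^sup>2 * t\<^sup>2)\<^sup>2"
    by algebra
  then show ?thesis
    using quartic_denom_pos[of t t] by simp
qed

lemma quartic_double:
  "quartic_add (t, v) (t, v) =
     (2 * t * v / (1 + 4 * t ^ 4),
      ((1 - 4 * t ^ 4) * (v\<^sup>2 + 4 * t\<^sup>2) - 16 * t ^ 4) / (1 + 4 * t ^ 4)\<^sup>2)"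
  by (simp add: algebra_simps eval_nat_numeral)

text \<open>
  The \<open>t\<close>-coordinates of \<open>A\<close> and of \<open>A + (1, -1)\<close> determine the \<open>v\<close>-coordinate of \<open>A\<close>. This reduces
  associativity to its \<open>t\<close>-coordinate together with the special case where one summand is \<open>(1, -1)\<close>.
\<close>

lemma quartic_add_fst_assoc:
  assumes "P \<in> quartic_points" "Q \<in> quartic_points" "R \<in> quartic_points"
  shows "fst (quartic_add (quartic_add P Q) R) = fst (quartic_add P (quartic_add Q R))"
proof -
  obtain t1 v1 t2 v2 t3 v3 where PQR: "P = (t1, v1)" "Q = (t2, v2)" "R = (t3, v3)" by (metis surj_pair)
  define D where "D = 1 + 4 * t1\<^sup>2 * t2\<^sup>2"
  define N where "N = t1 * v2 + v1 * t2"
  define M where "M = (1 - 4 * t1\<^sup>2 * t2\<^sup>2) * (v1 * v2 + 4 * t1 * t2) - 8 * t1 * t2 * (t1\<^sup>2 + t2\<^sup>2)"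
  define D' where "D' = 1 + 4 * t2\<^sup>2 * t3\<^sup>2"
  define N' where "N' = t2 * v3 + v2 * t3"
  define M' where "M' = (1 - 4 * t2\<^sup>2 * t3\<^sup>2) * (v2 * v3 + 4 * t2 * t3) - 8 * t2 * t3 * (t2\<^sup>2 + t3\<^sup>2)"
  have "v1\<^sup>2 = 1 + 4 * t1\<^sup>2 - 4 * t1 ^ 4" "v2\<^sup>2 = 1 + 4 * t2\<^sup>2 - 4 * t2 ^ 4" "v3\<^sup>2 = 1 + 4 * t3\<^sup>2 - 4 * t3 ^ 4"
    using assms by (simp_all add: PQR quartic_points_iff)
  then have eq: "(N * D * v3 + M * t3) * (D'\<^sup>2 + 4 * t1\<^sup>2 * N'\<^sup>2) = (t1 * M' + v1 * N' * D') * (D\<^sup>2 + 4 * N\<^sup>2 * t3\<^sup>2)"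
    unfolding D_def N_def M_def D'_def N'_def M'_def by algebra
  have D: "D > 0" "D' > 0"
    using quartic_denom_pos by (auto simp: D_def D'_def)
  then have pos: "D\<^sup>2 + 4 * N\<^sup>2 * t3\<^sup>2 > 0" "D'\<^sup>2 + 4 * t1\<^sup>2 * N'\<^sup>2 > 0"
    by (simp_all add: add_pos_nonneg)
  have L: "(N / D * v3 + M / D\<^sup>2 * t3) / (1 + 4 * (N / D)\<^sup>2 * t3\<^sup>2) = (N * D * v3 + M * t3) / (D\<^sup>2 + 4 * N\<^sup>2 * t3\<^sup>2)"
  proof -
    have "N / D * v3 + M / D\<^sup>2 * t3 = (N * D * v3 + M * t3) / D\<^sup>2"
      using D by (simp add: field_simps power2_eq_square)
    moreover have "1 + 4 * (N / D)\<^sup>2 * t3\<^sup>2 = (D\<^sup>2 + 4 * N\<^sup>2 * t3\<^sup>2) / D\<^sup>2"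
      using D by (simp add: field_simps)
    ultimately show ?thesis using D by simp
  qed
  have R: "(t1 * (M' / D'\<^sup>2) + v1 * (N' / D')) / (1 + 4 * t1\<^sup>2 * (N' / D')\<^sup>2) = (t1 * M' + v1 * N' * D') / (D'\<^sup>2 + 4 * t1\<^sup>2 * N'\<^sup>2)"
  proof -
    have "t1 * (M' / D'\<^sup>2) + v1 * (N' / D') = (t1 * M' + v1 * N' * D') / D'\<^sup>2"
      using D by (simp add: field_simps power2_eq_square)
    moreover have "1 + 4 * t1\<^sup>2 * (N' / D')\<^sup>2 = (D'\<^sup>2 + 4 * t1\<^sup>2 * N'\<^sup>2) / D'\<^sup>2"
      using D by (simp add: field_simps)
    ultimately show ?thesis using D by simp
  qed
  have "fst (quartic_add (quartic_add P Q) R) = (N / D * v3 + M / D\<^sup>2 * t3) / (1 + 4 * (N / D)\<^sup>2 * t3\<^sup>2)"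
    by (simp add: PQR D_def N_def M_def)
  also have "\<dots> = (t1 * (M' / D'\<^sup>2) + v1 * (N' / D')) / (1 + 4 * t1\<^sup>2 * (N' / D')\<^sup>2)"
    using eq pos unfolding L R by (simp add: frac_eq_eq)
  also have "\<dots> = fst (quartic_add P (quartic_add Q R))"
    by (simp add: PQR D'_def N'_def M'_def)
  finally show ?thesis .
qed

lemma quartic_points_gen: "(1, -1) \<in> quartic_points"
  by (simp add: quartic_points_iff)

lemma quartic_add_gen:
  "quartic_add (t, v) (1, -1) =
     ((v - t) / (1 + 4 * t\<^sup>2), ((1 - 4 * t\<^sup>2) * (4 * t - v) - 8 * t * (1 + t\<^sup>2)) / (1 + 4 * t\<^sup>2)\<^sup>2)"
  by (simp add: add.commute)

text \<open>The \<open>v\<close>-coordinate is checked directly here, where fixing the third summand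
  leaves an identity in \<open>t1\<close>, \<open>v1\<close>, \<open>t2\<close>, \<open>v2\<close>
  modulo two curve equations.\<close>

lemma quartic_add_assoc_gen:
  assumes "P \<in> quartic_points" "Q \<in> quartic_points"
  shows "quartic_add (quartic_add P Q) (1, -1) = quartic_add P (quartic_add Q (1, -1))"
proof (rule prod_eqI)
  show "fst (quartic_add (quartic_add P Q) (1, -1)) = fst (quartic_add P (quartic_add Q (1, -1)))"
    using assms quartic_points_gen by (rule quartic_add_fst_assoc)
next
  obtain t1 v1 t2 v2 where PQ: "P = (t1, v1)" "Q = (t2, v2)" by fastforce
  define D where "D = 1 + 4 * t1\<^sup>2 * t2\<^sup>2"
  define N where "N = t1 * v2 + v1 * t2"
  define M where "M = (1 - 4 * t1\<^sup>2 * t2\<^sup>2) * (v1 * v2 + 4 * t1 * t2) - 8 * t1 * t2 * (t1\<^sup>2 + t2\<^sup>2)"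
  define D' where "D' = 1 + 4 * t2\<^sup>2"
  define N' where "N' = v2 - t2"
  define M' where "M' = (1 - 4 * t2\<^sup>2) * (4 * t2 - v2) - 8 * t2 * (1 + t2\<^sup>2)"
  have "v1\<^sup>2 = 1 + 4 * t1\<^sup>2 - 4 * t1 ^ 4" "v2\<^sup>2 = 1 + 4 * t2\<^sup>2 - 4 * t2 ^ 4"
    using assms by (simp_all add: PQ quartic_points_iff)
  then have eq:
    "((D\<^sup>2 - 4 * N\<^sup>2) * (4 * N * D - M) - 8 * N * D * (D\<^sup>2 + N\<^sup>2)) * (D'\<^sup>2 + 4 * t1\<^sup>2 * N'\<^sup>2)\<^sup>2 =
     ((D'\<^sup>2 - 4 * t1\<^sup>2 * N'\<^sup>2) * (v1 * M' + 4 * t1 * N' * D') - 8 * t1 * N' * D' * (t1\<^sup>2 * D'\<^sup>2 + N'\<^sup>2))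
       * (D\<^sup>2 + 4 * N\<^sup>2)\<^sup>2"
    unfolding D_def N_def M_def D'_def N'_def M'_def by algebra
  have D: "D > 0" "D' > 0"
    using quartic_denom_pos[of t1 t2] quartic_denom_pos[of 1 t2] by (auto simp: D_def D'_def)
  then have pos: "D\<^sup>2 + 4 * N\<^sup>2 > 0" "D'\<^sup>2 + 4 * t1\<^sup>2 * N'\<^sup>2 > 0"
    by (simp_all add: add_pos_nonneg)
  have L: "((1 - 4 * (N / D)\<^sup>2) * (4 * (N / D) - M / D\<^sup>2) - 8 * (N / D) * (1 + (N / D)\<^sup>2)) / (1 + 4 * (N / D)\<^sup>2)\<^sup>2
     = ((D\<^sup>2 - 4 * N\<^sup>2) * (4 * N * D - M) - 8 * N * D * (D\<^sup>2 + N\<^sup>2)) / (D\<^sup>2 + 4 * N\<^sup>2)\<^sup>2"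
  proof -
    have "(1 - 4 * (N / D)\<^sup>2) * (4 * (N / D) - M / D\<^sup>2) - 8 * (N / D) * (1 + (N / D)\<^sup>2) =
        ((D\<^sup>2 - 4 * N\<^sup>2) * (4 * N * D - M) - 8 * N * D * (D\<^sup>2 + N\<^sup>2)) / D ^ 4"
      using D by (simp add: divide_simps) algebra
    moreover have "(1 + 4 * (N / D)\<^sup>2)\<^sup>2 = (D\<^sup>2 + 4 * N\<^sup>2)\<^sup>2 / D ^ 4"
      using D by (simp add: divide_simps)
    ultimately show ?thesis using D by simp
  qed
  have R: "((1 - 4 * t1\<^sup>2 * (N' / D')\<^sup>2) * (v1 * (M' / D'\<^sup>2) + 4 * t1 * (N' / D')) - 8 * t1 * (N' / D') * (t1\<^sup>2 + (N' / D')\<^sup>2))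
      / (1 + 4 * t1\<^sup>2 * (N' / D')\<^sup>2)\<^sup>2
     = ((D'\<^sup>2 - 4 * t1\<^sup>2 * N'\<^sup>2) * (v1 * M' + 4 * t1 * N' * D') - 8 * t1 * N' * D' * (t1\<^sup>2 * D'\<^sup>2 + N'\<^sup>2))
      / (D'\<^sup>2 + 4 * t1\<^sup>2 * N'\<^sup>2)\<^sup>2"
  proof -
    have "(1 - 4 * t1\<^sup>2 * (N' / D')\<^sup>2) * (v1 * (M' / D'\<^sup>2) + 4 * t1 * (N' / D')) - 8 * t1 * (N' / D') * (t1\<^sup>2 + (N' / D')\<^sup>2) =
        ((D'\<^sup>2 - 4 * t1\<^sup>2 * N'\<^sup>2) * (v1 * M' + 4 * t1 * N' * D') - 8 * t1 * N' * D' * (t1\<^sup>2 * D'\<^sup>2 + N'\<^sup>2)) / D' ^ 4"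
      using D by (simp add: divide_simps) algebra
    moreover have "(1 + 4 * t1\<^sup>2 * (N' / D')\<^sup>2)\<^sup>2 = (D'\<^sup>2 + 4 * t1\<^sup>2 * N'\<^sup>2)\<^sup>2 / D' ^ 4"
      using D by (simp add: divide_simps)
    ultimately show ?thesis using D by simp
  qed
  have "snd (quartic_add (quartic_add P Q) (1, -1)) =
      ((1 - 4 * (N / D)\<^sup>2) * (4 * (N / D) - M / D\<^sup>2) - 8 * (N / D) * (1 + (N / D)\<^sup>2)) / (1 + 4 * (N / D)\<^sup>2)\<^sup>2"
    unfolding PQ quartic_add.simps[of t1] D_def[symmetric] N_def[symmetric] M_def[symmetric] quartic_add_gen by simp
  also have "\<dots> = ((1 - 4 * t1\<^sup>2 * (N' / D')\<^sup>2) * (v1 * (M' / D'\<^sup>2) + 4 * t1 * (N' / D')) - 8 * t1 * (N' / D') * (t1\<^sup>2 + (N' / D')\<^sup>2))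
      / (1 + 4 * t1\<^sup>2 * (N' / D')\<^sup>2)\<^sup>2"
    using eq pos unfolding L R by (simp add: frac_eq_eq)
  also have "\<dots> = snd (quartic_add P (quartic_add Q (1, -1)))"
    unfolding PQ quartic_add_gen D'_def[symmetric] N'_def[symmetric] M'_def[symmetric] by simp
  finally show "snd (quartic_add (quartic_add P Q) (1, -1)) = snd (quartic_add P (quartic_add Q (1, -1)))" .
qed

lemma quartic_add_assoc:
  assumes "P \<in> quartic_points" "Q \<in> quartic_points" "R \<in> quartic_points"
  shows "quartic_add (quartic_add P Q) R = quartic_add P (quartic_add Q R)" (is "?A = ?B")
proof -
  let ?G = "(1, -1) :: rat \<times> rat"
  note closed = quartic_add_closed quartic_points_gen
  have "fst (quartic_add ?A ?G) = fst (quartic_add (quartic_add P Q) (quartic_add R ?G))"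
    using assms closed by (simp add: quartic_add_fst_assoc)
  also have "\<dots> = fst (quartic_add P (quartic_add Q (quartic_add R ?G)))"
    using assms closed by (simp add: quartic_add_fst_assoc)
  \<comment> \<open>The rewriting takes place inside a summand, so equality of first coordinates
    would not suffice; this is where both coordinates of \<open>quartic_add_assoc_gen\<close> are
    used.\<close>
  also have "\<dots> = fst (quartic_add P (quartic_add (quartic_add Q R) ?G))"
    using assms by (simp add: quartic_add_assoc_gen)
  also have "\<dots> = fst (quartic_add ?B ?G)"
    using assms closed by (simp add: quartic_add_fst_assoc)
  finally have gen: "fst (quartic_add ?A ?G) = fst (quartic_add ?B ?G)" .
  obtain t v t' v' where AB: "?A = (t, v)" "?B = (t', v')" by fastforce
  have "t = t'"
    using quartic_add_fst_assoc[OF assms] AB by simp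
  moreover from this have "v = v'"
    using gen quartic_denom_pos[of 1 t'] by (simp add: AB quartic_add_gen del: quartic_add.simps)
  ultimately show ?thesis by (simp add: AB)
qed

lemma quartic_group_comm_group: "comm_group quartic_group"
proof (rule comm_groupI, goal_cases)
  case (4 P Q)
  then show ?case
    using quartic_add_commute by (simp del: quartic_add.simps)
next
  case (6 P)
  then show ?case
    using quartic_add_neg quartic_add_commute
    by (cases P) (force simp: quartic_points_iff simp del: quartic_add.simps intro!: bexI[of _ "(- fst P, snd P)"])
qed (simp_all add: quartic_add_closed quartic_add_assoc quartic_points_iff del: quartic_add.simps)

section \<open>The isomorphism from the Weierstrass form to the quartic\<close>

fun to_quartic :: "ec_point \<Rightarrow> rat \<times> rat" where
  "to_quartic Infinity = (0, 1)"
| "to_quartic (Affine X Y) = (2 * Y / (X\<^sup>2 + 16), (X\<^sup>2 + 8 * X - 16) / (X\<^sup>2 + 16))"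

lemma ec_points_iff [simp]:
  "Infinity \<in> ec_points a b c"
  "Affine x y \<in> ec_points a b c \<longleftrightarrow> y\<^sup>2 = x ^ 3 + a * x\<^sup>2 + b * x + c"
  by (auto simp: ec_points_def)

text \<open>The cubic of the curve is \<open>(X + 4) (X^2 + 16)\<close>. Its second factor has no
  rational zero, so the denominators in \<open>to_quartic\<close> never vanish.\<close>

lemma sq_plus_16_pos: "(X :: rat)\<^sup>2 + 16 > 0"
  by (simp add: add_nonneg_pos)

lemma to_quartic_closed:
  assumes "P \<in> ec_points 4 16 64"
  shows "to_quartic P \<in> quartic_points"
proof (cases P)
  case (Affine X Y)
  define K where "K = X\<^sup>2 + 16"
  have K: "K \<noteq> 0"
    using sq_plus_16_pos[of X] by (simp add: K_def)
  have "Y\<^sup>2 = X ^ 3 + 4 * X\<^sup>2 + 16 * X + 64"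
    using assms Affine by simp
  then have "(X\<^sup>2 + 8 * X - 16)\<^sup>2 * K\<^sup>2 = K ^ 4 + 16 * Y\<^sup>2 * K\<^sup>2 - 64 * Y ^ 4"
    unfolding K_def by algebra
  moreover have "((X\<^sup>2 + 8 * X - 16) / K)\<^sup>2 = (X\<^sup>2 + 8 * X - 16)\<^sup>2 * K\<^sup>2 / K ^ 4"
    using K by (simp add: power_divide eval_nat_numeral)
  ultimately have "((X\<^sup>2 + 8 * X - 16) / K)\<^sup>2 = (K ^ 4 + 16 * Y\<^sup>2 * K\<^sup>2 - 64 * Y ^ 4) / K ^ 4"
    by simp
  also have "\<dots> = 1 + 4 * (2 * Y / K)\<^sup>2 - 4 * (2 * Y / K) ^ 4"
    using K by (simp add: field_simps eval_nat_numeral)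
  finally show ?thesis
    by (simp add: Affine quartic_points_iff K_def)
qed (simp add: quartic_points_iff)

text \<open>
  The hypotheses say that the line \<open>Y = l X + n\<close> meets the curve in points with abscissae
  \<open>X1\<close>, \<open>X2\<close>, \<open>X3\<close> counted with multiplicity, so chords and tangents are covered alike.
\<close>

lemma to_quartic_line:
  fixes X1 X2 X3 l n :: rat
  assumes X3: "X3 = l\<^sup>2 - 4 - X1 - X2"
    and e2: "X1 * X2 + (X1 + X2) * X3 = 16 - 2 * l * n"
    and e3: "X1 * X2 * X3 = n\<^sup>2 - 64"
    and Y: "Y1 = l * X1 + n" "Y2 = l * X2 + n"
  shows "to_quartic (Affine X3 (- (l * X3 + n))) = quartic_add (to_quartic (Affine X1 Y1)) (to_quartic (Affine X2 Y2))"
proof -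
  define K1 K2 K3 c1 c2 V1 V2
    where defs: "K1 = X1\<^sup>2 + 16" "K2 = X2\<^sup>2 + 16" "K3 = X3\<^sup>2 + 16" "c1 = X1 + 4" "c2 = X2 + 4"
      "V1 = X1\<^sup>2 + 8 * X1 - 16" "V2 = X2\<^sup>2 + 8 * X2 - 16"
  define Q where "Q = K1 * K2 + 64 * c1 * c2"
  have K: "K1 > 0" "K2 > 0" "K3 > 0"
    using sq_plus_16_pos by (simp_all add: defs)
  have t: "- (l * X3 + n) * Q = K3 * (Y1 * V2 + Y2 * V1)"
    using e2 e3 unfolding Q_def defs Y X3 by algebra
  have v: "(X3\<^sup>2 + 8 * X3 - 16) * Q\<^sup>2 =
      K3 * ((K1 * K2 - 64 * c1 * c2) * (V1 * V2 + 16 * Y1 * Y2) - 128 * Y1 * Y2 * (c1 * K2 + c2 * K1))"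
    using e2 e3 unfolding Q_def defs Y X3 by algebra
  \<comment> \<open>By Vieta the three assumptions say that
    \<open>X^3 + 4 X^2 + 16 X + 64 - (l X + n)^2\<close> has the roots \<open>X1\<close>,
    \<open>X2\<close>, \<open>X3\<close>; hence both points lie on the curve.\<close>
  have "Y1\<^sup>2 = c1 * K1" "Y2\<^sup>2 = c2 * K2"
    using e2 e3 unfolding Q_def defs Y X3 by algebra+
  \<comment> \<open>The squares of the \<open>t\<close>-coordinates depend on the abscissae alone,
    which turns the denominator of the addition law into \<open>Q / (K1 * K2)\<close>.\<close>
  then have t2: "(2 * Y1 / K1)\<^sup>2 = 4 * c1 / K1" "(2 * Y2 / K2)\<^sup>2 = 4 * c2 / K2"
    using K by (simp_all add: power_divide power2_eq_square)
  have D: "1 + 4 * (2 * Y1 / K1)\<^sup>2 * (2 * Y2 / K2)\<^sup>2 = Q / (K1 * K2)"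
    unfolding t2 using K by (simp add: Q_def field_simps)
  then have "Q / (K1 * K2) > 0"
    using quartic_denom_pos[of "2 * Y1 / K1" "2 * Y2 / K2"] by simp
  then have Q: "Q > 0"
    using K by (metis mult_pos_pos zero_less_divide_iff order_less_asym)
  have "2 * - (l * X3 + n) / K3 = 2 * (Y1 * V2 + Y2 * V1) / Q"
    using t Q K by (simp add: frac_eq_eq) algebra
  also have "\<dots> = (2 * Y1 / K1 * (V2 / K2) + V1 / K1 * (2 * Y2 / K2)) / (Q / (K1 * K2))"
  proof -
    have "2 * Y1 / K1 * (V2 / K2) + V1 / K1 * (2 * Y2 / K2) = 2 * (Y1 * V2 + Y2 * V1) / (K1 * K2)"
      by (simp add: add_divide_distrib algebra_simps)
    then show ?thesis using K by simp
  qed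
  finally have fst: "2 * - (l * X3 + n) / K3 =
    (2 * Y1 / K1 * (V2 / K2) + V1 / K1 * (2 * Y2 / K2)) / (Q / (K1 * K2))" .
  have "(X3\<^sup>2 + 8 * X3 - 16) / K3 =
     ((K1 * K2 - 64 * c1 * c2) * (V1 * V2 + 16 * Y1 * Y2) - 128 * Y1 * Y2 * (c1 * K2 + c2 * K1)) / Q\<^sup>2"
    using v Q K by (simp add: frac_eq_eq mult.commute)
  also have "\<dots> = ((1 - 4 * (4 * c1 / K1) * (4 * c2 / K2)) * (V1 / K1 * (V2 / K2) + 4 * (2 * Y1 / K1) * (2 * Y2 / K2)) -
      8 * (2 * Y1 / K1) * (2 * Y2 / K2) * (4 * c1 / K1 + 4 * c2 / K2)) / (Q / (K1 * K2))\<^sup>2"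
  proof -
    have "(1 - 4 * (4 * c1 / K1) * (4 * c2 / K2)) * (V1 / K1 * (V2 / K2) + 4 * (2 * Y1 / K1) * (2 * Y2 / K2)) -
      8 * (2 * Y1 / K1) * (2 * Y2 / K2) * (4 * c1 / K1 + 4 * c2 / K2) =
      ((K1 * K2 - 64 * c1 * c2) * (V1 * V2 + 16 * Y1 * Y2) - 128 * Y1 * Y2 * (c1 * K2 + c2 * K1)) / (K1 * K2)\<^sup>2"
      using K by (simp add: field_simps power2_eq_square)
    then show ?thesis using K by (simp add: power_divide)
  qed
  finally have snd: "(X3\<^sup>2 + 8 * X3 - 16) / K3 = \<dots>" .
  show ?thesis
    unfolding to_quartic.simps defs(1-3,6,7)[symmetric] quartic_add.simps D fst snd
    unfolding t2 by (rule refl)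
qed

text \<open>Apart from opposite points and \<open>Infinity\<close>, the sum is read off from a line
  \<open>Y = l X + n\<close>. Chord and tangent differ only in how \<open>e2\<close> is obtained;
  \<open>e3\<close> and the membership of the third point follow uniformly.\<close>

lemma to_quartic_ec_add:
  assumes "P \<in> ec_points 4 16 64" "Q \<in> ec_points 4 16 64"
  shows "ec_add 4 16 64 P Q \<in> ec_points 4 16 64 \<and>
    to_quartic (ec_add 4 16 64 P Q) = quartic_add (to_quartic P) (to_quartic Q)"
proof (cases "P = Infinity \<or> Q = Infinity")
  case True
  then show ?thesis
    using assms by (auto simp: ec_add_def simp del: quartic_add.simps split: ec_point.splits)
next
  case False
  then obtain X1 Y1 X2 Y2 where PQ: "P = Affine X1 Y1" "Q = Affine X2 Y2"
    by (meson ec_point.exhaust)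
  have curve: "Y1\<^sup>2 = X1 ^ 3 + 4 * X1\<^sup>2 + 16 * X1 + 64" "Y2\<^sup>2 = X2 ^ 3 + 4 * X2\<^sup>2 + 16 * X2 + 64"
    using assms by (simp_all add: PQ)
  show ?thesis
  proof (cases "X1 = X2 \<and> Y1 = - Y2")
    case True
    have "quartic_add (to_quartic Q) (to_quartic P) = (0, 1)"
      using quartic_add_neg[of "2 * Y2 / (X2\<^sup>2 + 16)" "(X2\<^sup>2 + 8 * X2 - 16) / (X2\<^sup>2 + 16)"]
        to_quartic_closed[OF assms(2)] True by (simp add: PQ del: quartic_add.simps)
    then show ?thesis
      using True by (simp add: PQ ec_add_def quartic_add_commute del: quartic_add.simps)
  next
    case False
    define l where "l = (if X1 = X2 then (3 * X1\<^sup>2 + 2 * 4 * X1 + 16) / (2 * Y1) else (Y2 - Y1) / (X2 - X1))"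
    define n where "n = Y1 - l * X1"
    define X3 where "X3 = l\<^sup>2 - 4 - X1 - X2"
    have Y1: "Y1 = l * X1 + n" by (simp add: n_def)
    have "Y2 = l * X2 + n \<and> X1 * X2 + (X1 + X2) * X3 = 16 - 2 * l * n"
    proof (cases "X1 = X2")
      case True
      then have "Y1\<^sup>2 = Y2\<^sup>2"
        using curve by simp
      then have "Y1 = Y2" "Y1 \<noteq> 0"
        using False True by (auto simp: power2_eq_iff)
      \<comment> \<open>The tangent slope makes \<open>X1\<close> a double root of the cubic minus
        the square of the line.\<close>
      then have "2 * l * Y1 = 3 * X1\<^sup>2 + 8 * X1 + 16"
        using True by (simp add: l_def)
      then have "X1 * X1 + (X1 + X1) * (l\<^sup>2 - 4 - X1 - X1) = 16 - 2 * l * (Y1 - l * X1)"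
        by algebra
      then show ?thesis
        using True \<open>Y1 = Y2\<close> by (simp add: X3_def n_def)
    next
      case False
      then have "l * (X2 - X1) = Y2 - Y1"
        by (simp add: l_def)
      then have Y2: "Y2 = l * X2 + n"
        by (simp add: n_def algebra_simps)
      \<comment> \<open>Up to sign this is the difference of the two curve equations, with
        \<open>X1 - X2\<close> split off.\<close>
      have "(X1 - X2) * (X1 * X2 + (X1 + X2) * X3 - (16 - 2 * l * n)) = 0"
        using curve unfolding Y1 Y2 X3_def by algebra
      then show ?thesis
        using False Y2 by simp
    qed
    then have Y2: "Y2 = l * X2 + n" and e2: "X1 * X2 + (X1 + X2) * X3 = 16 - 2 * l * n"
      by simp_all
    have e3: "X1 * X2 * X3 = n\<^sup>2 - 64"
      using curve(1) e2 unfolding Y1 X3_def by algebra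
    have "(- (l * X3 + n))\<^sup>2 = X3 ^ 3 + 4 * X3\<^sup>2 + 16 * X3 + 64"
      using e2 e3 unfolding X3_def by algebra
    moreover have "to_quartic (Affine X3 (- (l * X3 + n))) = quartic_add (to_quartic P) (to_quartic Q)"
      unfolding PQ using X3_def e2 e3 Y1 Y2 by (rule to_quartic_line)
    moreover have "ec_add 4 16 64 P Q = Affine X3 (l * (X1 - X3) - Y1)"
      using False unfolding PQ ec_add_def by (auto simp: Let_def X3_def l_def)
    moreover have "l * (X1 - X3) - Y1 = - (l * X3 + n)"
      by (simp add: n_def algebra_simps)
    ultimately show ?thesis by (simp del: to_quartic.simps quartic_add.simps)
  qed
qed

lemma bij_betw_to_quartic: "bij_betw to_quartic (ec_points 4 16 64) quartic_points"
proof -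
  \<comment> \<open>For the inverse, \<open>t^2 = 4 (X + 4) / (X^2 + 16)\<close> and
    \<open>1 + v = 2 X (X + 4) / (X^2 + 16)\<close> give \<open>X\<close> as a quotient, and then
    \<open>Y = t (X^2 + 16) / 2\<close>. The value \<open>t = 0\<close> belongs to
    \<open>Infinity\<close> and to the point with \<open>Y = 0\<close>.\<close>
  define g where "g = (\<lambda>(t, v). if t = 0 then (if v = 1 then Infinity else Affine (-4) 0)
    else Affine (2 * (1 + v) / t\<^sup>2) (4 * (1 + v + 2 * t\<^sup>2) / t ^ 3))"
  show ?thesis
  proof (rule bij_betw_byWitness[where f' = g])
    show "\<forall>P\<in>ec_points 4 16 64. g (to_quartic P) = P"
    proof
      fix P assume P: "P \<in> ec_points 4 16 64"
      show "g (to_quartic P) = P"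
      proof (cases P)
        case (Affine X Y)
        define K where "K = X\<^sup>2 + 16"
        have K: "K > 0"
          using sq_plus_16_pos[of X] by (simp add: K_def)
        have "Y\<^sup>2 = X ^ 3 + 4 * X\<^sup>2 + 16 * X + 64"
          using P Affine by simp
        then have curve: "Y\<^sup>2 = (X + 4) * K"
          unfolding K_def by algebra
        show ?thesis
        proof (cases "Y = 0")
          case True
          then have "X = -4"
            using curve K by (simp add: add_eq_0_iff)
          then show ?thesis
            using True by (simp add: Affine g_def)
        next
          case False
          have X: "1 + (X\<^sup>2 + 8 * X - 16) / K = 2 * X * (X + 4) / K"
            using K by (simp add: field_simps) (simp add: K_def power2_eq_square)
          have t: "(2 * Y / K)\<^sup>2 = 4 * (X + 4) / K"
            unfolding power_divide power_mult_distrib curve using K by (simp add: power2_eq_square)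
          have "X + 4 \<noteq> 0"
            using False curve by auto
          moreover have "2 * (2 * x * c / K) / (4 * c / K) = x" if "c \<noteq> 0" for x c
            using that K by (simp add: field_simps)
          ultimately have "2 * (2 * X * (X + 4) / K) / (4 * (X + 4) / K) = X"
            by blast
          moreover have "4 * (2 * X * (X + 4) / K + 2 * (4 * (X + 4) / K)) / (2 * Y / K) ^ 3 = Y"
          proof -
            have "(2 * Y / K) ^ 3 = (2 * Y / K) * (4 * (X + 4) / K)"
              unfolding t[symmetric] by (simp add: power3_eq_cube power2_eq_square)
            also have "\<dots> * Y = 8 * (X + 4) * Y\<^sup>2 / K\<^sup>2"
              by (simp add: power2_eq_square)
            also have "\<dots> = 8 * (X + 4)\<^sup>2 / K"
              unfolding curve using K by (simp add: power2_eq_square)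
            also have "\<dots> = 4 * (2 * X * (X + 4) / K + 2 * (4 * (X + 4) / K))"
              by (simp add: power2_eq_square algebra_simps add_divide_distrib)
            finally show ?thesis
              using False K by (simp add: nonzero_divide_eq_eq mult.commute[of Y])
          qed
          ultimately show ?thesis
            using False K unfolding Affine to_quartic.simps K_def[symmetric] g_def prod.case X t by simp
        qed
      qed (simp add: g_def)
    qed
  next
    show "\<forall>A\<in>quartic_points. to_quartic (g A) = A"
    proof
      fix A assume "A \<in> quartic_points"
      then obtain t v where A: "A = (t, v)" and v: "v\<^sup>2 = 1 + 4 * t\<^sup>2 - 4 * t ^ 4"
        by (auto simp: quartic_points_def)
      show "to_quartic (g A) = A"
      proof (cases "t = 0")
        case True
        then have "v = 1 \<or> v = -1"
          using v by (simp add: power2_eq_1_iff)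
        then show ?thesis
          using True by (auto simp: A g_def)
      next
        case False
        \<comment> \<open>\<open>8 W / t^4\<close> is the value of \<open>X^2 + 16\<close> at the
          preimage, so \<open>W\<close> must not vanish.\<close>
        define W where "W = 1 + v + 2 * t\<^sup>2"
        have W: "W \<noteq> 0"
        proof
          assume "W = 0"
          then have "8 * t ^ 4 = 0"
            using v unfolding W_def by algebra
          then show False using False by simp
        qed
        have K: "(2 * (1 + v) / t\<^sup>2)\<^sup>2 + 16 = 8 * W / t ^ 4"
        proof -
          have "4 * (1 + v)\<^sup>2 + 16 * t ^ 4 = 8 * W"
            using v unfolding W_def by algebra
          then show ?thesis
            using False by (simp add: field_simps eval_nat_numeral)
        qed
        have V: "(2 * (1 + v) / t\<^sup>2)\<^sup>2 + 8 * (2 * (1 + v) / t\<^sup>2) - 16 = 8 * v * W / t ^ 4"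
        proof -
          have "4 * (1 + v)\<^sup>2 + 16 * (1 + v) * t\<^sup>2 - 16 * t ^ 4 = 8 * v * W"
            using v unfolding W_def by algebra
          moreover have "(2 * (1 + v) / t\<^sup>2)\<^sup>2 + 8 * (2 * (1 + v) / t\<^sup>2) - 16 =
              (4 * (1 + v)\<^sup>2 + 16 * (1 + v) * t\<^sup>2 - 16 * t ^ 4) / t ^ 4"
            using False by (simp add: field_simps eval_nat_numeral)
          ultimately show ?thesis by simp
        qed
        have "2 * (4 * W / t ^ 3) / (8 * W / t ^ 4) = t"
          using False W by (simp add: field_simps eval_nat_numeral)
        moreover have "8 * v * W / t ^ 4 / (8 * W / t ^ 4) = v"
          using False W by simp
        ultimately show ?thesis
          unfolding A g_def prod.case if_not_P[OF False] to_quartic.simps W_def[symmetric] K V by simp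
      qed
    qed
  next
    show "to_quartic ` ec_points 4 16 64 \<subseteq> quartic_points"
      using to_quartic_closed by blast
  next
    show "g ` quartic_points \<subseteq> ec_points 4 16 64"
    proof
      fix P assume "P \<in> g ` quartic_points"
      then obtain t v where P: "P = g (t, v)" and v: "v\<^sup>2 = 1 + 4 * t\<^sup>2 - 4 * t ^ 4"
        by (auto simp: quartic_points_def)
      show "P \<in> ec_points 4 16 64"
      proof (cases "t = 0")
        case False
        have "(4 * (1 + v + 2 * t\<^sup>2))\<^sup>2 = 8 * (1 + v) ^ 3 + 16 * (1 + v)\<^sup>2 * t\<^sup>2 + 32 * (1 + v) * t ^ 4 + 64 * t ^ 6"
          using v by algebra
        moreover have "(t ^ 3)\<^sup>2 = t ^ 6"
          by (simp flip: power_mult)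
        ultimately have "(4 * (1 + v + 2 * t\<^sup>2) / t ^ 3)\<^sup>2 =
          (8 * (1 + v) ^ 3 + 16 * (1 + v)\<^sup>2 * t\<^sup>2 + 32 * (1 + v) * t ^ 4 + 64 * t ^ 6) / t ^ 6"
          by (simp only: power_divide)
        also have "\<dots> = (2 * (1 + v) / t\<^sup>2) ^ 3 + 4 * (2 * (1 + v) / t\<^sup>2)\<^sup>2 + 16 * (2 * (1 + v) / t\<^sup>2) + 64"
          using False by (simp add: field_simps eval_nat_numeral)
        finally show ?thesis
          using False by (simp add: P g_def)
      qed (simp add: P g_def)
    qed
  qed
qed

lemma ec_group_simps [simp]:
  "carrier (ec_group a b c) = ec_points a b c"
  "x \<otimes>\<^bsub>ec_group a b c\<^esub> y = ec_add a b c x y"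
  "\<one>\<^bsub>ec_group a b c\<^esub> = Infinity"
  by (simp_all add: ec_group_def)

lemma to_quartic_iso: "to_quartic \<in> iso (ec_group 4 16 64) quartic_group"
  using bij_betw_to_quartic to_quartic_ec_add to_quartic_closed
  by (intro isoI homI) auto

text \<open>Associativity, commutativity and inverses are pulled back along the bijection
  \<open>to_quartic\<close>, which avoids the case distinctions of the chord-and-tangent
  law.\<close>

lemma ec_group_comm_group: "comm_group (ec_group 4 16 64)"
proof -
  interpret J: comm_group quartic_group by (rule quartic_group_comm_group)
  have inj: "P = Q" if "to_quartic P = to_quartic Q" "P \<in> ec_points 4 16 64" "Q \<in> ec_points 4 16 64" for P Q
    using that bij_betw_to_quartic by (meson bij_betw_def inj_onD)
  note hom = to_quartic_ec_add[THEN conjunct1] to_quartic_ec_add[THEN conjunct2] to_quartic_closed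
  show ?thesis
  proof (rule comm_groupI, goal_cases)
    case (3 P Q R)
    then have "quartic_add (quartic_add (to_quartic P) (to_quartic Q)) (to_quartic R) =
        quartic_add (to_quartic P) (quartic_add (to_quartic Q) (to_quartic R))"
      using to_quartic_closed by (intro quartic_add_assoc) simp_all
    with 3 show ?case
      by (intro inj) (simp_all add: hom del: quartic_add.simps)
  next
    case (4 P Q)
    then show ?case
      using quartic_add_commute[of "to_quartic P"] by (intro inj) (simp_all add: hom del: quartic_add.simps)
  next
    case (6 P)
    then obtain A where A: "A \<in> quartic_points" "quartic_add A (to_quartic P) = (0, 1)"
      using J.l_inv_ex[of "to_quartic P"] to_quartic_closed by (auto simp del: quartic_add.simps)
    have "A \<in> to_quartic ` ec_points 4 16 64"
      using A(1) bij_betw_imp_surj_on[OF bij_betw_to_quartic] by simp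
    then obtain Q where Q: "Q \<in> ec_points 4 16 64" "to_quartic Q = A"
      by (elim imageE) simp
    have "ec_add 4 16 64 Q P = Infinity"
    proof (rule inj)
      show "to_quartic (ec_add 4 16 64 Q P) = to_quartic Infinity"
        using 6 Q A hom(2)[of Q P] by (simp del: quartic_add.simps)
    qed (use 6 Q hom(1) in simp_all)
    with Q show ?case by auto
  qed (simp_all add: hom(1), simp add: ec_add_def)
qed

section \<open>Descent\<close>

text \<open>The factors are positive, so the claim reduces to natural numbers, where coprime factors
  of an n-th power are n-th powers.\<close>

lemma fourth_powers_of_coprime_mult:
  fixes A B c :: int
  assumes "A * B = c ^ 4" "coprime A B" "A > 0" "B > 0"
  obtains a b where "A = a ^ 4" "B = b ^ 4" "a > 0" "b > 0"
proof -
  have "int (nat A * nat B) = int (nat \<bar>c\<bar> ^ 4)"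
    using assms by simp
  then have "nat A * nat B = nat \<bar>c\<bar> ^ 4"
    by (simp only: of_nat_eq_iff)
  moreover have "coprime (nat A) (nat B)"
    using assms by (simp add: coprime_int_iff[symmetric])
  ultimately have "is_nth_power 4 (nat A)" "is_nth_power 4 (nat B)"
    using is_nth_power_mult_coprime_nat_iff[of "nat A" "nat B" 4] by auto
  then obtain a b where "nat A = a ^ 4" "nat B = b ^ 4"
    by (auto elim!: is_nth_powerE)
  then have "A = int a ^ 4" "B = int b ^ 4"
    using assms by (metis int_nat_eq of_nat_power order_less_imp_le)+
  moreover from this have "int a > 0" "int b > 0"
    using assms by (auto intro: gr0I)
  ultimately show thesis
    using that by blast
qed

lemma odd_square_mod_4: "odd (a :: int) \<Longrightarrow> a\<^sup>2 mod 4 = 1"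
proof -
  assume "odd a"
  then obtain b where "a = 2 * b + 1" by (elim oddE)
  then have "a\<^sup>2 = 4 * (b\<^sup>2 + b) + 1" by algebra
  then show ?thesis by presburger
qed

text \<open>The second number is odd as well, so the sum of squares is 2 modulo 4. This excludes
  even denominators and one branch of the halving.\<close>

lemma not_4_dvd_sum_odd_squares:
  fixes a b :: int
  assumes "odd a" "a\<^sup>2 + b\<^sup>2 = 4 * k"
  shows False
proof -
  have "odd b"
    using assms by (metis dvd_triv_left even_add even_mult_iff even_numeral even_power zero_less_numeral)
  then have "(a\<^sup>2 + b\<^sup>2) mod 4 = (1 + 1) mod 4"
    using assms(1) odd_square_mod_4 by (metis mod_add_eq)
  then show False
    using assms(2) by simp
qed

text \<open>If \<open>e\<close> were even, then \<open>w\<close> would be even and \<open>s\<close>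
  odd, and division by 4 would make \<open>s^4 + (w/2)^2\<close> a multiple of 4.\<close>

lemma quartic_int_odd:
  fixes s e w :: int
  assumes w: "w\<^sup>2 = e ^ 4 + 4 * s\<^sup>2 * e\<^sup>2 - 4 * s ^ 4" and "coprime s e"
  shows "odd e" "odd w"
proof -
  show "odd e"
  proof
    assume "even e"
    then obtain k where k: "e = 2 * k" by blast
    have "even (w\<^sup>2)"
      unfolding w using \<open>even e\<close> by simp
    then obtain w' where w': "w = 2 * w'" by auto
    have "4 * (w'\<^sup>2 + (s\<^sup>2)\<^sup>2) = 4 * (4 * (k ^ 4 + s\<^sup>2 * k\<^sup>2))"
      using w unfolding k w' by algebra
    then have "(s\<^sup>2)\<^sup>2 + w'\<^sup>2 = 4 * (k ^ 4 + s\<^sup>2 * k\<^sup>2)"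
      by simp
    moreover have "odd s"
      using assms(2) \<open>even e\<close> by (metis coprime_common_divisor odd_one)
    ultimately show False
      using not_4_dvd_sum_odd_squares[of "s\<^sup>2" w'] even_power by blast
  qed
  then have "odd (w\<^sup>2)"
    unfolding w by simp
  then show "odd w" by simp
qed

text \<open>In the halving step two factors are known only through their product and their sum;
  positivity and coprimality have to be derived from these.\<close>

lemma pos_of_mult_add_pos:
  fixes A B :: int
  assumes "A * B > 0" "A + B > 0"
  shows "A > 0" "B > 0"
  using assms by (auto simp: zero_less_mult_iff)

lemma coprime_4_left_iff_odd: "coprime 4 (e :: int) \<longleftrightarrow> odd e"
  using coprime_power_left_iff[of 2 2 e] by simp

lemma coprime_of_coprime_mult_add:
  fixes A B :: int
  assumes "coprime (A * B) (A + B)"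
  shows "coprime A B"
proof -
  have "coprime A (A + B)"
    using assms by simp
  then show ?thesis
    using gcd_add2[of A B] by (simp add: coprime_iff_gcd_eq_1)
qed

text \<open>
  Halving a point: first \<open>(e\<^sup>2 + 2 s\<^sup>2)\<^sup>2 - w\<^sup>2 = 8 s\<^sup>4\<close> splits into coprime factors \<open>2 b\<^sup>4\<close> and \<open>a\<^sup>4\<close>,
  so that \<open>e\<^sup>2 = (a\<^sup>2 - b\<^sup>2)\<^sup>2 + b\<^sup>4\<close>; then \<open>b\<close> is even and this Pythagorean equation splits again.
\<close>

lemma quartic_int_halve:
  fixes s e w :: int
  assumes w: "w\<^sup>2 = e ^ 4 + 4 * s\<^sup>2 * e\<^sup>2 - 4 * s ^ 4" and "coprime s e" "e > 0" "even s"
  obtains f g a where "f > 0" "e = f ^ 4 + 4 * g ^ 4" "s = 2 * a * f * g"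
    "a\<^sup>2 = f ^ 4 + 4 * f\<^sup>2 * g\<^sup>2 - 4 * g ^ 4"
proof (cases "s = 0")
  case True
  \<comment> \<open>Zero is split off because the factorizations below need positive
    factors.\<close>
  then have "e = 1" using assms by simp
  then show thesis using True that[of 1 0 1] by simp
next
  case False
  note result = that
  \<comment> \<open>Replacing \<open>w\<close> by \<open>- w\<close> exchanges \<open>A\<close> and
    \<open>B\<close>. Stating the argument for both signs allows the even factor to be called
    \<open>A\<close>.\<close>
  have halve: thesis if w: "w\<^sup>2 = e ^ 4 + 4 * s\<^sup>2 * e\<^sup>2 - 4 * s ^ 4"
    and A: "2 * A = e\<^sup>2 + 2 * s\<^sup>2 - w" and B: "2 * B = e\<^sup>2 + 2 * s\<^sup>2 + w" and "even A" for w A B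
  proof -
    have e: "odd e" using quartic_int_odd[OF w assms(2)] by simp
    have "4 * (A * B) = 4 * (2 * s ^ 4)"
      using w A B by algebra
    then have AB: "A * B = 2 * s ^ 4" by simp
    have sum: "A + B = e\<^sup>2 + 2 * s\<^sup>2" using A B by simp
    have pos: "A > 0" "B > 0"
      using pos_of_mult_add_pos[of A B] AB sum False assms(3) by (simp_all add: add_pos_nonneg)
    have "coprime s (e\<^sup>2 + 2 * s\<^sup>2)"
      using assms(2) gcd_add_mult[of s "2 * s" "e\<^sup>2"]
      by (simp add: power2_eq_square coprime_iff_gcd_eq_1[symmetric] add.commute mult.assoc)
    \<comment> \<open>The sum \<open>e^2 + 2 s^2\<close> is odd and prime to \<open>s\<close>, hence
      prime to \<open>2 s^4\<close>.\<close>
    then have "coprime (A * B) (A + B)"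
      unfolding AB sum using e by simp
    then have "coprime A B" by (rule coprime_of_coprime_mult_add)
    obtain A' where A': "A = 2 * A'" using \<open>even A\<close> by blast
    have "A' * B = s ^ 4" "coprime A' B" "A' > 0"
      using AB \<open>coprime A B\<close> pos by (simp_all add: A')
    then obtain b a where ba: "A' = b ^ 4" "B = a ^ 4" "b > 0" "a > 0"
      using pos by (elim fourth_powers_of_coprime_mult)
    have "(a * b) ^ 4 = s ^ 4"
      using \<open>A' * B = s ^ 4\<close> ba by (simp add: power_mult_distrib mult.commute)
    then have s: "s = a * b \<or> s = - a * b"
      using power_eq_iff_eq_base[of 4 "a * b" "\<bar>s\<bar>"] ba by auto
    have "odd B"
      using sum e A' by (metis even_add even_mult_iff even_power dvd_triv_left zero_less_numeral)
    then have "odd a" by (simp add: ba)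
    then have "even b" using s \<open>even s\<close> by auto
    then obtain c where c: "b = 2 * c" by blast
    define q where "q = a\<^sup>2 - b\<^sup>2"
    have s2: "s\<^sup>2 = a\<^sup>2 * b\<^sup>2" using s by (auto simp: power_mult_distrib)
    have eq: "e\<^sup>2 - q\<^sup>2 = 16 * c ^ 4"
      using sum unfolding q_def s2 A' ba c by algebra
    have "odd q" using \<open>odd a\<close> \<open>even b\<close> by (simp add: q_def)
    have "even (e - q)" "even (e + q)" using e \<open>odd q\<close> by auto
    then obtain U V where UV: "e - q = 2 * U" "e + q = 2 * V" by (elim evenE)
    have sumUV: "U + V = e" using UV by simp
    have "4 * (U * V) = 4 * (4 * c ^ 4)"
      using eq UV by algebra
    then have prodUV: "U * V = 4 * c ^ 4" by simp
    have "c > 0" using ba c by simp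
    have posUV: "U > 0" "V > 0"
      using pos_of_mult_add_pos[of U V] prodUV sumUV \<open>c > 0\<close> \<open>e > 0\<close> by simp_all
    have "c dvd s" using s c by auto
    then have "coprime c e" using assms(2) by (meson coprime_divisors dvd_refl)
    then have "coprime (U * V) (U + V)"
      unfolding prodUV sumUV using e by (simp add: coprime_4_left_iff_odd)
    then have copUV: "coprime U V" by (rule coprime_of_coprime_mult_add)
    \<comment> \<open>The even one of two coprime factors of \<open>4 c^4\<close> absorbs the whole
      4; what remains is a product of coprime fourth powers.\<close>
    have split: "\<exists>f g. f > 0 \<and> U = 4 * g ^ 4 \<and> V = f ^ 4 \<and> c = f * g"
      if "U * V = 4 * c ^ 4" "coprime U V" "U > 0" "V > 0" "even U" for U V
    proof -
      have "odd V" using that by (metis coprime_common_divisor odd_one)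
      then have "coprime 4 V" by (simp add: coprime_4_left_iff_odd)
      moreover have "4 dvd U * V" using that by simp
      ultimately have "4 dvd U" by (simp add: coprime_dvd_mult_left_iff)
      then obtain U' where U': "U = 4 * U'" by blast
      have "U' * V = c ^ 4" "coprime U' V" "U' > 0"
        using that by (simp_all add: U')
      then obtain g f where gf: "U' = g ^ 4" "V = f ^ 4" "g > 0" "f > 0"
        using \<open>V > 0\<close> by (elim fourth_powers_of_coprime_mult)
      have "(f * g) ^ 4 = c ^ 4"
        using \<open>U' * V = c ^ 4\<close> gf by (simp add: power_mult_distrib mult.commute)
      then have "c = f * g"
        using power_eq_iff_eq_base[of 4 "f * g" c] gf \<open>c > 0\<close> by auto
      then show ?thesis using gf U' by blast
    qed
    show thesis
    proof (cases "even U")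
      case True
      then obtain f g where fg: "f > 0" "U = 4 * g ^ 4" "V = f ^ 4" "c = f * g"
        using split prodUV copUV posUV by blast
      \<comment> \<open>Here \<open>q = V - U\<close> and \<open>a^2 = q + 4 c^2\<close>. The result
        says that \<open>(g/f, a/f^2)\<close> lies on the quartic again.\<close>
      have a: "a\<^sup>2 = f ^ 4 + 4 * f\<^sup>2 * g\<^sup>2 - 4 * g ^ 4"
        using UV fg(2-4) c unfolding q_def by algebra
      have e: "e = f ^ 4 + 4 * g ^ 4"
        using sumUV fg by simp
      from s show thesis
      proof
        assume "s = a * b"
        then show thesis using result[OF fg(1) e _ a] fg(4) c by simp
      next
        assume "s = - a * b"
        then show thesis using result[OF fg(1) e, of "- a"] a fg(4) c by simp
      qed
    next
      case False
      then have "even V" using prodUV by (metis even_mult_iff even_numeral)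
      then obtain f g where fg: "f > 0" "V = 4 * g ^ 4" "U = f ^ 4" "c = f * g"
        using split[of V U] prodUV copUV posUV by (metis coprime_commute mult.commute)
      \<comment> \<open>With \<open>V\<close> even, \<open>q\<close> changes sign in terms of
        \<open>f\<close> and \<open>g\<close>, and two odd squares would add up to a multiple of
        4.\<close>
      have "a\<^sup>2 + (f\<^sup>2)\<^sup>2 = 4 * (f\<^sup>2 * g\<^sup>2 + g ^ 4)"
        using UV fg(2-4) c unfolding q_def by algebra
      then show thesis
        using not_4_dvd_sum_odd_squares \<open>odd a\<close> by blast
    qed
  qed
  have odd: "odd e" "odd w" using quartic_int_odd[OF w assms(2)] by simp_all
  then have "even (e\<^sup>2 + 2 * s\<^sup>2 - w)" "even (e\<^sup>2 + 2 * s\<^sup>2 + w)" by simp_all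
  then obtain A B where AB: "e\<^sup>2 + 2 * s\<^sup>2 - w = 2 * A" "e\<^sup>2 + 2 * s\<^sup>2 + w = 2 * B" by (elim evenE)
  have "4 * (A * B) = 4 * (2 * s ^ 4)"
    using w AB by algebra
  then have "even (A * B)" by simp
  then consider "even A" | "even B" by auto
  then show thesis
  proof cases
    case 1
    then show thesis using halve[OF w, of A B] AB by simp
  next
    case 2
    then show thesis using halve[of "- w" B A] AB w by simp
  qed
qed

section \<open>From rational points to integer solutions\<close>

lemma rat_sqrt_of_int_is_int:
  fixes x :: rat
  assumes "x\<^sup>2 = of_int N"
  obtains w where "x = of_int w"
proof -
  obtain m n where mn: "quotient_of x = (m, n)" by fastforce
  have n: "n > 0" "coprime m n" "x = of_int m / of_int n"
    using quotient_of_denom_pos[OF mn] quotient_of_coprime[OF mn] quotient_of_div[OF mn] .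
  then have "(of_int m)\<^sup>2 = of_int N * (of_int n :: rat)\<^sup>2"
    unfolding assms[symmetric] by (simp add: power_divide)
  then have "m\<^sup>2 = N * n\<^sup>2"
    by (metis of_int_eq_iff of_int_mult of_int_power)
  then have "n\<^sup>2 dvd m\<^sup>2" by simp
  then have "n dvd m" by simp
  then have "n = 1"
    using n by (simp add: coprime_absorb_right)
  then show thesis using n that by simp
qed

text \<open>Multiplying the equation by \<open>e^4\<close> shows that the square of
  \<open>v e^2\<close> is an integer, so \<open>v e^2\<close> itself is one.\<close>

lemma quartic_point_int:
  assumes "(t, v) \<in> quartic_points" "quotient_of t = (s, e)"
  obtains w where "v = of_int w / of_int e ^ 2" "w\<^sup>2 = e ^ 4 + 4 * s\<^sup>2 * e\<^sup>2 - 4 * s ^ 4"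
proof -
  have e: "e > 0" "t = of_int s / of_int e"
    using quotient_of_denom_pos[OF assms(2)] quotient_of_div[OF assms(2)] .
  have "v\<^sup>2 = 1 + 4 * t\<^sup>2 - 4 * t ^ 4"
    using assms(1) by (simp add: quartic_points_iff)
  also have "\<dots> * of_int e ^ 4 = of_int e ^ 4 + 4 * of_int s ^ 2 * of_int e ^ 2 - 4 * of_int s ^ 4"
    unfolding e(2) using e(1) by (simp add: field_simps eval_nat_numeral)
  finally have *: "(v * of_int e ^ 2)\<^sup>2 = of_int (e ^ 4 + 4 * s\<^sup>2 * e\<^sup>2 - 4 * s ^ 4)"
    by (simp add: power_mult_distrib flip: power_mult)
  then obtain w where w: "v * of_int e ^ 2 = of_int w"
    by (rule rat_sqrt_of_int_is_int)
  have "w\<^sup>2 = e ^ 4 + 4 * s\<^sup>2 * e\<^sup>2 - 4 * s ^ 4"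
    using * unfolding w by (metis of_int_eq_iff of_int_power)
  moreover have "v = of_int w / of_int e ^ 2"
    using e(1) by (simp flip: w)
  ultimately show thesis by (rule that[rotated])
qed

lemma quotient_of_denom_dvd:
  assumes "quotient_of (of_int x / of_int y) = (s, e)" "y \<noteq> 0"
  shows "e dvd y" "s * y = x * e"
proof -
  have e: "e > 0" "coprime s e" "of_int x / of_int y = (of_int s / of_int e :: rat)"
    using quotient_of_denom_pos[OF assms(1)] quotient_of_coprime[OF assms(1)] quotient_of_div[OF assms(1)] .
  then have "of_int (s * y) = (of_int (x * e) :: rat)"
    using assms(2) by (simp add: field_simps)
  then show *: "s * y = x * e" by (simp only: of_int_eq_iff)
  then have "e dvd s * y" by simp
  then show "e dvd y"
    using e(2) by (simp add: coprime_commute coprime_dvd_mult_right_iff)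
qed

text \<open>With an odd denominator, cancellation removes odd factors only; parity can be read off
  before reducing.\<close>

lemma even_num_quotient_iff:
  assumes "odd y"
  shows "even (fst (quotient_of (of_int x / of_int y))) \<longleftrightarrow> even x"
proof -
  obtain s e where se: "quotient_of (of_int x / of_int y) = (s, e)" by fastforce
  have "y \<noteq> 0" using assms by auto
  from quotient_of_denom_dvd[OF se this] have "e dvd y" "s * y = x * e" .
  moreover from this have "odd e" using assms dvd_trans by blast
  ultimately show ?thesis
    using assms by (metis even_mult_iff fst_conv se)
qed

lemma quartic_add_gen_int:
  assumes "e > 0"
  shows "fst (quartic_add (of_int s / of_int e, of_int w / of_int e ^ 2) (1, -1)) =
    of_int (w - s * e) / of_int (e\<^sup>2 + 4 * s\<^sup>2)"
proof -
  have "of_int w / of_int e ^ 2 - of_int s / of_int e = (of_int (w - s * e) / of_int e ^ 2 :: rat)"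
    using assms by (simp add: field_simps power2_eq_square)
  moreover have "1 + 4 * (of_int s / of_int e)\<^sup>2 = (of_int (e\<^sup>2 + 4 * s\<^sup>2) / of_int e ^ 2 :: rat)"
    using assms by (simp add: field_simps)
  ultimately show ?thesis
    using assms unfolding quartic_add_gen fst_conv by simp
qed

text \<open>The new fraction is \<open>(w - s e) / (e^2 + 4 s^2)\<close> with \<open>w\<close>,
  \<open>e\<close> and the denominator odd. This parity change brings the descent into the even case
  and also proves that \<open>(1, -1)\<close> has infinite order.\<close>

lemma even_num_quartic_add_gen:
  assumes "P \<in> quartic_points"
  shows "even (fst (quotient_of (fst (quartic_add P (1, -1))))) \<longleftrightarrow> odd (fst (quotient_of (fst P)))"
proof -
  obtain t v where P: "P = (t, v)" by fastforce
  obtain s e where se: "quotient_of t = (s, e)" by fastforce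
  then obtain w where w: "v = of_int w / of_int e ^ 2" "w\<^sup>2 = e ^ 4 + 4 * s\<^sup>2 * e\<^sup>2 - 4 * s ^ 4"
    using assms unfolding P by (elim quartic_point_int)
  have e: "e > 0" "coprime s e" "t = of_int s / of_int e"
    using quotient_of_denom_pos[OF se] quotient_of_coprime[OF se] quotient_of_div[OF se] .
  have odd: "odd e" "odd w"
    using quartic_int_odd[OF w(2) e(2)] .
  have "fst (quartic_add P (1, -1)) = of_int (w - s * e) / of_int (e\<^sup>2 + 4 * s\<^sup>2)"
    unfolding P w(1) e(3) using e(1) by (rule quartic_add_gen_int)
  moreover have "odd (e\<^sup>2 + 4 * s\<^sup>2)" using odd by simp
  ultimately have "even (fst (quotient_of (fst (quartic_add P (1, -1))))) \<longleftrightarrow> even (w - s * e)"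
    using even_num_quotient_iff by metis
  then show ?thesis
    using odd by (simp add: P se)
qed

text \<open>The half is \<open>(g/f, a/f^2)\<close>, with \<open>e = f^4 + 4 g^4\<close> giving the
  size bound. Only the \<open>t\<close>-coordinate of the double is controlled; the sign of
  \<open>v\<close> is settled where the lemma is applied.\<close>

lemma quartic_halve:
  assumes "(t, v) \<in> quartic_points" "quotient_of t = (s, e)" "even s"
  obtains R where "R \<in> quartic_points" "fst (quartic_add R R) = t" "snd (quotient_of (fst R)) ^ 4 \<le> e"
proof -
  obtain w where w: "w\<^sup>2 = e ^ 4 + 4 * s\<^sup>2 * e\<^sup>2 - 4 * s ^ 4"
    using assms(1,2) by (elim quartic_point_int)
  have e: "e > 0" "coprime s e" "t = of_int s / of_int e"
    using quotient_of_denom_pos[OF assms(2)] quotient_of_coprime[OF assms(2)] quotient_of_div[OF assms(2)] .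
  obtain f g a where fga: "f > 0" "e = f ^ 4 + 4 * g ^ 4" "s = 2 * a * f * g"
    "a\<^sup>2 = f ^ 4 + 4 * f\<^sup>2 * g\<^sup>2 - 4 * g ^ 4"
    using quartic_int_halve[OF w e(2,1) assms(3)] by blast
  define F G A :: rat where FGA: "F = of_int f" "G = of_int g" "A = of_int a"
  have F: "F > 0" using fga(1) by (simp add: FGA)
  have "of_int (a\<^sup>2) = (of_int (f ^ 4 + 4 * f\<^sup>2 * g\<^sup>2 - 4 * g ^ 4) :: rat)"
    using fga(4) by simp
  then have A: "A\<^sup>2 = F ^ 4 + 4 * F\<^sup>2 * G\<^sup>2 - 4 * G ^ 4"
    by (simp add: FGA)
  have "(A / F\<^sup>2)\<^sup>2 = A\<^sup>2 / F ^ 4"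
    by (simp add: power_divide flip: power_mult)
  also have "\<dots> = 1 + 4 * (G / F)\<^sup>2 - 4 * (G / F) ^ 4"
    unfolding A using F by (simp add: field_simps eval_nat_numeral)
  finally have "(G / F, A / F\<^sup>2) \<in> quartic_points"
    by (simp add: quartic_points_iff)
  moreover have "fst (quartic_add (G / F, A / F\<^sup>2) (G / F, A / F\<^sup>2)) = t"
  proof -
    have pos: "F ^ 4 + 4 * G ^ 4 > 0" using F by (simp add: add_pos_nonneg)
    have "1 + 4 * (G / F) ^ 4 = (F ^ 4 + 4 * G ^ 4) / F ^ 4"
      using F by (simp add: field_simps)
    moreover have "2 * (G / F) * (A / F\<^sup>2) = 2 * A * F * G / F ^ 4"
      using F by (simp add: eval_nat_numeral)
    ultimately have "2 * (G / F) * (A / F\<^sup>2) / (1 + 4 * (G / F) ^ 4) = 2 * A * F * G / (F ^ 4 + 4 * G ^ 4)"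
      using F by simp
    then show ?thesis
      unfolding quartic_double e(3) fga(2,3) by (simp add: FGA)
  qed
  \<comment> \<open>The fraction \<open>g/f\<close> need not be reduced here; its reduced
    denominator divides \<open>f\<close>.\<close>
  moreover have "snd (quotient_of (G / F)) ^ 4 \<le> e"
  proof -
    obtain s' e' where q: "quotient_of (of_int g / of_int f) = (s', e')" by fastforce
    then have "e' dvd f" "e' > 0"
      using quotient_of_denom_dvd(1)[OF q] quotient_of_denom_pos[OF q] fga(1) by auto
    then have "e' ^ 4 \<le> f ^ 4"
      using fga(1) zdvd_imp_le by (intro power_mono) auto
    then show ?thesis
      using q fga(2) by (simp add: FGA add_increasing2)
  qed
  ultimately show thesis
    using that by (metis fst_conv)
qed

text \<open>Combined with negation, this translation produces \<open>(t, -v)\<close>, the other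
  point over the same \<open>t\<close>.\<close>

lemma quartic_add_order2: "quartic_add (0, -1) (t, v) = (-t, -v)"
  by simp

interpretation J: comm_group quartic_group
  by (rule quartic_group_comm_group)

lemma quartic_inv: "(t, v) \<in> quartic_points \<Longrightarrow> inv\<^bsub>quartic_group\<^esub> (t, v) = (-t, v)"
  using quartic_add_neg[of "-t" v]
  by (intro J.inv_equality) (simp_all add: quartic_points_iff del: quartic_add.simps)

text \<open>On the real quartic \<open>t\<close> is bounded, since the leading coefficient is
  negative. The constant 5/4 for \<open>t^2\<close> yields
  \<open>e^2 + 4 s^2 <= 6 e^2\<close>.\<close>

lemma quartic_numerator_bound:
  fixes s e w :: int
  assumes "w\<^sup>2 = e ^ 4 + 4 * s\<^sup>2 * e\<^sup>2 - 4 * s ^ 4" "e > 0"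
  shows "4 * s\<^sup>2 \<le> 5 * e\<^sup>2"
proof (rule ccontr)
  assume "\<not> 4 * s\<^sup>2 \<le> 5 * e\<^sup>2"
  then have "4 * s\<^sup>2 > 5 * e\<^sup>2" by simp
  moreover have "e\<^sup>2 > 0" using assms(2) by simp
  ultimately have "e\<^sup>2 * (5 * e\<^sup>2) < (4 * s\<^sup>2 - 4 * e\<^sup>2) * (4 * s\<^sup>2)"
    by - (rule mult_strict_mono; linarith)
  moreover have "(4 * s\<^sup>2 - 4 * e\<^sup>2) * (4 * s\<^sup>2) = 4 * e ^ 4 - 4 * w\<^sup>2"
    using assms(1) by algebra
  moreover have "e\<^sup>2 * (5 * e\<^sup>2) = 5 * e ^ 4"
    by (simp flip: power_add)
  moreover have "e ^ 4 \<ge> 0" "w\<^sup>2 \<ge> 0" by simp_all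
  ultimately show False by linarith
qed

text \<open>Halving after a possible translation by \<open>(1, -1)\<close> leads to a denominator
  \<open>f\<close> with \<open>f^4 <= 6 e^2\<close>, which is less than \<open>e^4\<close> once
  \<open>e >= 3\<close>. The points with \<open>e = 1\<close> are listed by hand.\<close>

lemma quartic_group_generators:
  assumes "P \<in> quartic_points"
  shows "P \<in> generate quartic_group {(1, -1), (0, -1)}"
  using assms
proof (induction "nat (snd (quotient_of (fst P)))" arbitrary: P rule: less_induct)
  case less
  let ?S = "generate quartic_group {(1, -1), (0, -1)}"
  have gens: "(1, -1) \<in> ?S" "(0, -1) \<in> ?S" "(0, 1) \<in> ?S"
    using generate.one[of quartic_group] by (auto intro: generate.incl)
  have sub: "{(1, -1), (0, -1)} \<subseteq> carrier quartic_group"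
    by (simp add: quartic_points_iff)
  have mult: "quartic_add A B \<in> ?S" if "A \<in> ?S" "B \<in> ?S" for A B
    using generate.eng[OF that] by simp
  have neg: "(-t, v) \<in> ?S" if "(t, v) \<in> ?S" for t v
  proof -
    have "(t, v) \<in> quartic_points"
      using J.generate_in_carrier[OF sub that] by simp
    then show ?thesis
      using J.generate_m_inv_closed[OF sub that] quartic_inv by simp
  qed
  have flip: "(-t, -v) \<in> ?S" if "(t, v) \<in> ?S" for t v
    using mult[OF gens(2) that] by (simp only: quartic_add_order2)
  obtain t v where P: "P = (t, v)" by fastforce
  obtain s e where se: "quotient_of t = (s, e)" by fastforce
  obtain w where w: "v = of_int w / of_int e ^ 2" "w\<^sup>2 = e ^ 4 + 4 * s\<^sup>2 * e\<^sup>2 - 4 * s ^ 4"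
    using less.prems se unfolding P by (elim quartic_point_int)
  have e: "e > 0" "coprime s e" "t = of_int s / of_int e"
    using quotient_of_denom_pos[OF se] quotient_of_coprime[OF se] quotient_of_div[OF se] .
  have bound: "4 * s\<^sup>2 \<le> 5 * e\<^sup>2"
    using w(2) e(1) by (rule quartic_numerator_bound)
  have "odd e"
    using w(2) e(2) by (rule quartic_int_odd)
  \<comment> \<open>Oddness removes \<open>e = 2\<close>, for which \<open>6 e^2 < e^4\<close>
    fails.\<close>
  then have "e = 1 \<or> e \<ge> 3"
    using e(1) by presburger
  then consider "e = 1" | "e \<ge> 3" by blast
  then show ?case
  proof cases
    case 1
    then have "\<bar>s\<bar>\<^sup>2 < 2\<^sup>2" using bound by simp
    then have "\<bar>s\<bar> < 2" by (rule power2_less_imp_less) simp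
    then have "s = 0 \<or> s = 1 \<or> s = -1" by auto
    then have "w\<^sup>2 = 1" using w(2) 1 by auto
    then have "v = 1 \<or> v = -1" using w(1) 1 by (auto simp: power2_eq_1_iff)
    then show ?thesis
      using \<open>s = 0 \<or> s = 1 \<or> s = -1\<close> gens neg[OF gens(1)] flip[OF gens(1)] flip[OF neg[OF gens(1)]]
      by (auto simp: P e(3) 1)
  next
    case 2
    \<comment> \<open>The bound refers to the denominator of \<open>P\<close>, so that
      \<open>A\<close> may be \<open>P\<close> itself or \<open>P + (1, -1)\<close>.\<close>
    have halve: "A \<in> ?S" if A: "A \<in> quartic_points" "even (fst (quotient_of (fst A)))"
      "snd (quotient_of (fst A)) \<le> 6 * e\<^sup>2" for A
    proof -
      obtain t' v' where A': "A = (t', v')" by fastforce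
      obtain s' e' where se': "quotient_of t' = (s', e')" by fastforce
      obtain R where R: "R \<in> quartic_points" "fst (quartic_add R R) = t'" "snd (quotient_of (fst R)) ^ 4 \<le> e'"
        using quartic_halve[of t' v' s' e'] A se' unfolding A' by auto
      let ?f = "snd (quotient_of (fst R))"
      have f: "?f > 0"
        using quotient_of_denom_pos' .
      have "?f < e"
      proof (rule ccontr)
        assume "\<not> ?f < e"
        then have "e ^ 4 \<le> ?f ^ 4"
          using e(1) by (intro power_mono) auto
        then have "e\<^sup>2 * e\<^sup>2 \<le> 6 * e\<^sup>2"
          using R(3) A(3) se' by (simp add: A' flip: power_add)
        then have "e\<^sup>2 \<le> 6"
          using e(1) by (metis mult_le_cancel_right_pos zero_less_power)
        moreover have "3\<^sup>2 \<le> e\<^sup>2"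
          using 2 by (intro power_mono) auto
        ultimately show False by simp
      qed
      then have "R \<in> ?S"
        using R(1) f e(1) by (intro less.hyps) (simp_all add: P se)
      then have RR: "quartic_add R R \<in> ?S" by (intro mult)
      obtain v'' where v'': "quartic_add R R = (t', v'')"
        using R(2) by (metis prod.collapse)
      \<comment> \<open>Both points lie over \<open>t'\<close>, so \<open>A\<close> is
        \<open>2 R\<close> or its image under \<open>v -> -v\<close>.\<close>
      have "v'\<^sup>2 = v''\<^sup>2"
        using A(1) quartic_add_closed[OF R(1) R(1)] unfolding A' v'' by (simp add: quartic_points_iff)
      then show ?thesis
        using RR flip[OF neg[of t' v'']] unfolding A' v'' by (auto simp: power2_eq_iff)
    qed
    show ?thesis
    proof (cases "even s")
      case True
      have "e \<le> 6 * e\<^sup>2"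
        using e(1) by (simp add: power2_eq_square)
      then show ?thesis
        using halve[of P] True less.prems by (simp add: P se)
    next
      case False
      have A: "quartic_add P (1, -1) \<in> quartic_points"
        using less.prems quartic_points_gen by (rule quartic_add_closed)
      have fst: "fst (quartic_add P (1, -1)) = of_int (w - s * e) / of_int (e\<^sup>2 + 4 * s\<^sup>2)"
        unfolding P w(1) e(3) using e(1) by (rule quartic_add_gen_int)
      have pos: "e\<^sup>2 + 4 * s\<^sup>2 > 0" using e(1) by (simp add: add_pos_nonneg)
      obtain s' e' where se': "quotient_of (fst (quartic_add P (1, -1))) = (s', e')" by fastforce
      then have "e' dvd e\<^sup>2 + 4 * s\<^sup>2"
        unfolding fst by (rule quotient_of_denom_dvd(1)) (use pos in simp)
      then have "e' \<le> e\<^sup>2 + 4 * s\<^sup>2"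
        using pos by (rule zdvd_imp_le)
      then have "e' \<le> 6 * e\<^sup>2" using bound by simp
      moreover have "even s'"
        using even_num_quartic_add_gen[OF less.prems] False se' by (simp add: P se)
      ultimately have "quartic_add P (1, -1) \<in> ?S"
        using A se' by (intro halve) simp_all
      then have "quartic_add (quartic_add P (1, -1)) (-1, -1) \<in> ?S"
        using mult neg[OF gens(1)] by blast
      moreover have "quartic_add (quartic_add P (1, -1)) (-1, -1) = P"
        using less.prems quartic_add_assoc[of P "(1, -1)" "(-1, -1)"] quartic_add_neg[of 1 "-1"]
        by (simp add: quartic_points_iff del: quartic_add.simps)
      ultimately show ?thesis by simp
    qed
  qed
qed

text \<open>By parity a multiple with \<open>t = 0\<close> has even index \<open>n = 2 m\<close>.
  The doubling formula then gives \<open>t v = 0\<close> for the \<open>m\<close>-th multiple, where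
  \<open>v\<close> is nonzero because \<open>w\<close> is odd. Claiming \<open>t\<close> nonzero,
  instead of only excluding \<open>(0, 1)\<close>, makes the induction work.\<close>

lemma quartic_gen_pow_not_torsion:
  fixes n :: nat
  assumes "n > 0"
  shows "fst ((1, -1) [^]\<^bsub>quartic_group\<^esub> n) \<noteq> 0"
  using assms
proof (induction n rule: less_induct)
  case (less n)
  let ?g = "\<lambda>n :: nat. (1, -1) [^]\<^bsub>quartic_group\<^esub> n"
  have G: "(1, -1) \<in> carrier quartic_group"
    by (simp add: quartic_points_iff)
  have carrier: "?g n \<in> quartic_points" for n
    using J.nat_pow_closed[OF G] by simp
  have parity: "even (fst (quotient_of (fst (?g n)))) \<longleftrightarrow> even n" for n
  proof (induction n)
    case (Suc n)
    then show ?case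
      using even_num_quartic_add_gen[OF carrier[of n]] by (simp del: quartic_add.simps)
  qed simp
  show ?case
  proof
    assume 0: "fst (?g n) = 0"
    then have "even n" using parity[of n] by simp
    then obtain m where m: "n = 2 * m" by blast
    obtain t v where tv: "?g m = (t, v)" by fastforce
    have "?g n = quartic_add (t, v) (t, v)"
      using J.nat_pow_mult[OF G, of m m] by (simp add: m tv mult_2 del: quartic_add.simps)
    then have "2 * t * v / (1 + 4 * t ^ 4) = 0"
      using 0 by (simp add: quartic_double del: quartic_add.simps)
    moreover have "1 + 4 * t ^ 4 > 0"
      by (simp add: add_pos_nonneg)
    moreover have "v \<noteq> 0"
    proof -
      obtain s e where se: "quotient_of t = (s, e)" by fastforce
      obtain w where w: "v = of_int w / of_int e ^ 2" "w\<^sup>2 = e ^ 4 + 4 * s\<^sup>2 * e\<^sup>2 - 4 * s ^ 4"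
        using carrier[of m] se unfolding tv by (elim quartic_point_int)
      have "odd w"
        using w(2) quotient_of_coprime[OF se] by (rule quartic_int_odd)
      then show ?thesis
        using w(1) quotient_of_denom_pos[OF se] by auto
    qed
    ultimately have "fst (?g m) = 0" by (simp add: tv)
    then show False
      using less.IH[of m] less.prems m by simp
  qed
qed

section \<open>The rank\<close>

lemma (in comm_group) generate_two:
  assumes "g \<in> carrier G" "h \<in> carrier G" "x \<in> generate G {g, h}"
  shows "\<exists>(n :: int) (m :: int). x = g [^] n \<otimes> h [^] m"
  using assms(3)
proof induction
  case one
  show ?case
    using assms by (intro exI[of _ 0]) simp
next
  case (incl x)
  have "g = g [^] (1 :: int) \<otimes> h [^] (0 :: int)" "h = g [^] (0 :: int) \<otimes> h [^] (1 :: int)"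
    using assms by simp_all
  then show ?case using incl by blast
next
  case (inv x)
  have "inv g = g [^] (-1 :: int) \<otimes> h [^] (0 :: int)" "inv h = g [^] (0 :: int) \<otimes> h [^] (-1 :: int)"
    using assms by (simp_all add: int_pow_neg)
  then show ?case using inv by blast
next
  case (eng x y)
  then obtain n m n' m' :: int
    where "x = g [^] n \<otimes> h [^] m" "y = g [^] n' \<otimes> h [^] m'" by blast
  then have "x \<otimes> y = g [^] (n + n') \<otimes> h [^] (m + m')"
    using assms by (simp add: int_pow_mult m_ac)
  then show ?case by blast
qed

lemma (in comm_group) subgroup_torsion_elements: "subgroup (torsion_elements G) G"
proof
  show "torsion_elements G \<subseteq> carrier G"
    by (auto simp: torsion_elements_def)
  show "\<one> \<in> torsion_elements G"
    by (auto simp: torsion_elements_def intro!: exI[of _ 1])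
next
  fix x y assume "x \<in> torsion_elements G" "y \<in> torsion_elements G"
  then obtain n m :: nat where xy: "x \<in> carrier G" "y \<in> carrier G"
    and nm: "n > 0" "x [^] n = \<one>" "m > 0" "y [^] m = \<one>"
    by (auto simp: torsion_elements_def)
  have "(x \<otimes> y) [^] (n * m) = (x [^] n) [^] m \<otimes> (y [^] m) [^] n"
    using xy by (simp add: nat_pow_distrib nat_pow_pow mult.commute)
  then show "x \<otimes> y \<in> torsion_elements G"
    using xy nm by (auto simp: torsion_elements_def intro!: exI[of _ "n * m"])
next
  fix x assume "x \<in> torsion_elements G"
  then show "inv x \<in> torsion_elements G"
    by (auto simp: torsion_elements_def nat_pow_inv)
qed

lemma (in comm_group) int_pow_torsion_imp_zero:
  fixes n :: int
  assumes g: "g \<in> carrier G" "\<And>n :: nat. n > 0 \<Longrightarrow> g [^] n \<noteq> \<one>"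
    and "g [^] n \<in> torsion_elements G"
  shows "n = 0"
proof (rule ccontr)
  assume "n \<noteq> 0"
  obtain k :: nat where k: "k > 0" "(g [^] n) [^] k = \<one>"
    using assms(3) unfolding torsion_elements_def by blast
  then have *: "g [^] (n * int k) = \<one>"
    using g(1) by (metis int_pow_int int_pow_pow)
  then have "g [^] (- (n * int k)) = \<one>"
    using g(1) by (simp add: int_pow_neg)
  with * have "g [^] \<bar>n * int k\<bar> = \<one>"
    unfolding abs_if by presburger
  then have "g [^] int (nat \<bar>n * int k\<bar>) = \<one>"
    by simp
  then have "g [^] nat \<bar>n * int k\<bar> = \<one>"
    by (simp only: int_pow_int)
  then show False
    using g(2)[of "nat \<bar>n * int k\<bar>"] k(1) \<open>n \<noteq> 0\<close> by simp
qed

lemma (in group) infinite_carrierI: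
  assumes g: "g \<in> carrier G" "\<And>n :: nat. n > 0 \<Longrightarrow> g [^] n \<noteq> \<one>"
  shows "infinite (carrier G)"
proof
  assume "finite (carrier G)"
  moreover have "range (\<lambda>n :: nat. g [^] n) \<subseteq> carrier G"
    using g(1) by auto
  moreover have "inj (\<lambda>n :: nat. g [^] n)"
  proof (rule linorder_injI)
    fix n m :: nat
    assume "n < m"
    then have m: "g [^] m = g [^] n \<otimes> g [^] (m - n)" and "g [^] (m - n) \<noteq> \<one>"
      using g by (simp_all add: nat_pow_mult)
    then show "g [^] n \<noteq> g [^] m"
      unfolding m using g(1) by simp
  qed
  ultimately show False
    using finite_imageD finite_subset infinite_UNIV_nat by blast
qed

text \<open>The map \<open>(n, y) -> g^n y\<close> from the integers times the torsion subgroup is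
  an isomorphism; it is injective because only the zeroth power of \<open>g\<close> is torsion. The
  integers are then identified with the free abelian group on \<open>{..<1}\<close>.\<close>

lemma has_rank_1I:
  fixes G (structure)
  assumes "comm_group G" and g: "g \<in> carrier G" "\<And>n :: nat. n > 0 \<Longrightarrow> g [^] n \<noteq> \<one>"
    and fin: "finite (torsion_elements G)"
    and gen: "\<And>x. x \<in> carrier G \<Longrightarrow> \<exists>(n :: int). \<exists>y \<in> torsion_elements G. x = g [^] n \<otimes> y"
  shows "has_rank G 1"
proof -
  interpret comm_group G by fact
  let ?T = "G\<lparr>carrier := torsion_elements G\<rparr>"
  interpret T: group ?T
    by (rule subgroup.subgroup_is_group[OF subgroup_torsion_elements is_group])
  have T: "torsion_elements G \<subseteq> carrier G"
    by (auto simp: torsion_elements_def)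
  let ?\<phi> = "\<lambda>(n :: int, y). g [^] n \<otimes> y"
  have "?\<phi> \<in> iso (integer_group \<times>\<times> ?T) G"
  proof (rule isoI)
    show "?\<phi> \<in> hom (integer_group \<times>\<times> ?T) G"
      using g(1) T by (intro homI) (auto simp: int_pow_mult m_ac subset_iff)
    show "bij_betw ?\<phi> (carrier (integer_group \<times>\<times> ?T)) (carrier G)"
    proof (rule bij_betw_imageI)
      show "inj_on ?\<phi> (carrier (integer_group \<times>\<times> ?T))"
      proof (rule inj_onI, clarsimp)
        fix n m :: int and x y
        assume xy: "x \<in> torsion_elements G" "y \<in> torsion_elements G" and eq: "g [^] n \<otimes> x = g [^] m \<otimes> y"
        have c: "x \<in> carrier G" "y \<in> carrier G" using xy T by auto
        have "g [^] (n - m) = y \<otimes> inv x"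
        proof -
          have "g [^] (n - m) = g [^] n \<otimes> inv (g [^] m)"
            using g(1) by (simp add: int_pow_diff)
          also have "\<dots> = (g [^] n \<otimes> x) \<otimes> (inv x \<otimes> inv (g [^] m))"
            using g(1) c by (metis int_pow_closed inv_closed m_assoc m_closed r_inv r_one l_one)
          also have "\<dots> = y \<otimes> inv x"
            unfolding eq using g(1) c by (simp add: m_ac)
          finally show ?thesis .
        qed
        also have "\<dots> \<in> torsion_elements G"
          using xy subgroup_torsion_elements by (simp add: subgroup.m_closed subgroup.m_inv_closed)
        finally have "n - m = 0"
          using int_pow_torsion_imp_zero[of g "n - m"] g by blast
        then have "n = m" by simp
        then show "n = m \<and> x = y"
          using eq g(1) c by simp
      qed
      show "?\<phi> ` carrier (integer_group \<times>\<times> ?T) = carrier G"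
        using g(1) T gen by (force simp: image_iff)
    qed
  qed
  then have "integer_group \<times>\<times> ?T \<cong> G"
    by (rule is_isoI)
  then have "G \<cong> integer_group \<times>\<times> ?T"
    by (rule group.iso_sym[OF DirProd_group[OF group_integer_group T.is_group]])
  also have "\<dots> \<cong> free_Abelian_group {0 :: nat} \<times>\<times> ?T"
    by (rule group.DirProd_iso_trans[OF group_integer_group
          isomorphic_group_integer_free_Abelian_group_singleton iso_refl])
  finally have "G \<cong> free_Abelian_group {..<1 :: nat} \<times>\<times> ?T"
    by (simp add: lessThan_Suc)
  then show ?thesis
    unfolding has_rank_def using assms(1) fin by simp
qed

text \<open>The points \<open>(0, 8)\<close> and \<open>(-4, 0)\<close> correspond to the generators
  \<open>(1, -1)\<close> and \<open>(0, -1)\<close> of the quartic; the second one has order two and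
  gives all nontrivial torsion.\<close>

lemma ec_group_rank: "has_rank (ec_group 4 16 64) 1"
  and ec_points_infinite: "infinite (ec_points 4 16 64)"
proof -
  let ?E = "ec_group 4 16 64" and ?g = "Affine 0 8" and ?h = "Affine (-4) 0"
  interpret E: comm_group ?E by (rule ec_group_comm_group)
  interpret hom: group_hom ?E quartic_group to_quartic
    using to_quartic_iso by (simp add: group_hom_def group_hom_axioms_def E.is_group J.is_group iso_def)
  have inj: "inj_on to_quartic (ec_points 4 16 64)"
    using bij_betw_to_quartic by (rule bij_betw_imp_inj_on)
  have g: "?g \<in> carrier ?E" "to_quartic ?g = (1, -1)" and h: "?h \<in> carrier ?E" "to_quartic ?h = (0, -1)"
    by simp_all
  have hh: "?h \<otimes>\<^bsub>?E\<^esub> ?h = \<one>\<^bsub>?E\<^esub>"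
    by (simp add: ec_add_def)
  have order: "?g [^]\<^bsub>?E\<^esub> n \<noteq> \<one>\<^bsub>?E\<^esub>" if "n > 0" for n :: nat
  proof
    assume "?g [^]\<^bsub>?E\<^esub> n = \<one>\<^bsub>?E\<^esub>"
    then have "(1, -1) [^]\<^bsub>quartic_group\<^esub> n = (0, 1)"
      using hom.hom_nat_pow[OF g(1), of n] g(2) by simp
    then show False
      using quartic_gen_pow_not_torsion[OF that] by simp
  qed
  have h_pow: "?h [^]\<^bsub>?E\<^esub> (m :: int) \<in> {\<one>\<^bsub>?E\<^esub>, ?h}" for m
  proof -
    have sq: "?h [^]\<^bsub>?E\<^esub> (2 * k :: int) = \<one>\<^bsub>?E\<^esub>" for k
    proof -
      have "?h [^]\<^bsub>?E\<^esub> (2 * k) = ?h [^]\<^bsub>?E\<^esub> k \<otimes>\<^bsub>?E\<^esub> ?h [^]\<^bsub>?E\<^esub> k"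
        unfolding mult_2 using h(1) by (rule E.int_pow_mult)
      also have "\<dots> = (?h \<otimes>\<^bsub>?E\<^esub> ?h) [^]\<^bsub>?E\<^esub> k"
        using E.int_pow_distrib[OF h(1) h(1)] by (rule sym)
      also have "\<dots> = \<one>\<^bsub>?E\<^esub>"
        unfolding hh by (rule E.int_pow_one)
      finally show ?thesis .
    qed
    show ?thesis
    proof (cases "even m")
      case True
      then show ?thesis using sq by (auto elim!: evenE simp del: ec_group_simps)
    next
      case False
      then obtain k where "m = 2 * k + 1" by (elim oddE)
      then have "?h [^]\<^bsub>?E\<^esub> m = ?h [^]\<^bsub>?E\<^esub> (2 * k) \<otimes>\<^bsub>?E\<^esub> ?h [^]\<^bsub>?E\<^esub> (1 :: int)"
        using h(1) by (simp only: E.int_pow_mult)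
      then show ?thesis using sq h(1) by (simp del: ec_group_simps)
    qed
  qed
  have gen: "\<exists>(n :: int). \<exists>y \<in> {\<one>\<^bsub>?E\<^esub>, ?h}. x = ?g [^]\<^bsub>?E\<^esub> n \<otimes>\<^bsub>?E\<^esub> y" if "x \<in> carrier ?E" for x
  proof -
    have "to_quartic x \<in> generate quartic_group {(1, -1), (0, -1)}"
      using hom.hom_closed[OF that] quartic_group_generators by simp
    then obtain n m :: int where "to_quartic x =
        (1, -1) [^]\<^bsub>quartic_group\<^esub> n \<otimes>\<^bsub>quartic_group\<^esub> (0, -1) [^]\<^bsub>quartic_group\<^esub> m"
      using J.generate_two[OF hom.hom_closed[OF g(1)] hom.hom_closed[OF h(1)]] unfolding g(2) h(2) by blast
    also have "\<dots> = to_quartic (?g [^]\<^bsub>?E\<^esub> n \<otimes>\<^bsub>?E\<^esub> ?h [^]\<^bsub>?E\<^esub> m)"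
      using g h by (simp add: hom.hom_mult hom.hom_int_pow del: ec_group_simps quartic_group_simps to_quartic.simps)
    finally have "x = ?g [^]\<^bsub>?E\<^esub> n \<otimes>\<^bsub>?E\<^esub> ?h [^]\<^bsub>?E\<^esub> m"
    proof (rule inj_onD[OF inj])
      show "?g [^]\<^bsub>?E\<^esub> n \<otimes>\<^bsub>?E\<^esub> ?h [^]\<^bsub>?E\<^esub> m \<in> ec_points 4 16 64"
        using E.m_closed[OF E.int_pow_closed[OF g(1)] E.int_pow_closed[OF h(1)]] by simp
    qed (use that in simp)
    then show ?thesis using h_pow by blast
  qed
  have h_tor: "{\<one>\<^bsub>?E\<^esub>, ?h} \<subseteq> torsion_elements ?E"
  proof -
    have "?h [^]\<^bsub>?E\<^esub> (2 :: nat) = \<one>\<^bsub>?E\<^esub>"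
      using hh h(1) by (simp add: numeral_2_eq_2 del: ec_group_simps)
    then have "?h \<in> torsion_elements ?E"
      unfolding torsion_elements_def using h(1) zero_less_numeral by blast
    then show ?thesis
      using subgroup.one_closed[OF E.subgroup_torsion_elements] by blast
  qed
  have "torsion_elements ?E \<subseteq> {\<one>\<^bsub>?E\<^esub>, ?h}"
  proof
    fix x assume x: "x \<in> torsion_elements ?E"
    then have xE: "x \<in> carrier ?E"
      unfolding torsion_elements_def by blast
    then obtain n :: int and y where y: "y \<in> {\<one>\<^bsub>?E\<^esub>, ?h}" "x = ?g [^]\<^bsub>?E\<^esub> n \<otimes>\<^bsub>?E\<^esub> y"
      using gen by blast
    have yE: "y \<in> carrier ?E" using y(1) h(1) E.one_closed by blast
    have pow: "?g [^]\<^bsub>?E\<^esub> n \<in> carrier ?E" using g(1) by (rule E.int_pow_closed)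
    have "y \<in> torsion_elements ?E" using y(1) h_tor by blast
    \<comment> \<open>Dividing a torsion element by its part \<open>y\<close> leaves a torsion power
      of the generator, so the exponent is zero.\<close>
    then have "x \<otimes>\<^bsub>?E\<^esub> inv\<^bsub>?E\<^esub> y \<in> torsion_elements ?E"
      using x E.subgroup_torsion_elements by (intro subgroup.m_closed subgroup.m_inv_closed)
    moreover have "x \<otimes>\<^bsub>?E\<^esub> inv\<^bsub>?E\<^esub> y = ?g [^]\<^bsub>?E\<^esub> n"
      unfolding y(2) using pow yE by (simp add: E.m_assoc del: ec_group_simps)
    ultimately have "n = 0"
      using E.int_pow_torsion_imp_zero[OF g(1) order] by simp
    then have "x = y" using y(2) yE by (simp del: ec_group_simps)
    then show "x \<in> {\<one>\<^bsub>?E\<^esub>, ?h}" using y(1) by simp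
  qed
  then have T: "finite (torsion_elements ?E)"
    by (rule finite_subset) simp
  show "has_rank ?E 1"
    using ec_group_comm_group g(1) order T
  proof (rule has_rank_1I)
    fix x assume "x \<in> carrier ?E"
    then show "\<exists>(n :: int). \<exists>y \<in> torsion_elements ?E. x = ?g [^]\<^bsub>?E\<^esub> n \<otimes>\<^bsub>?E\<^esub> y"
      using gen h_tor by blast
  qed
  show "infinite (ec_points 4 16 64)"
    using E.infinite_carrierI[OF g(1) order] by simp
qed

section \<open>Quadratic factors of quartics\<close>

text \<open>Division with remainder: the quotient is \<open>x^2 + r x + s\<close>, and a remainder
  of degree at most one is divisible by the quadratic only if it is zero.\<close>

lemma quadratic_dvd_quartic_iff:
  fixes p q c0 c1 c2 c3 r s :: rat
  defines "r \<equiv> c3 - p" and "s \<equiv> c2 - q - p * r"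
  shows "[:q, p, 1:] dvd [:c0, c1, c2, c3, 1:] \<longleftrightarrow> q * s = c0 \<and> p * s + q * r = c1"
proof -
  let ?rem = "[:c0 - q * s, c1 - p * s - q * r:]"
  have "[:c0, c1, c2, c3, 1:] = [:q, p, 1:] * [:s, r, 1:] + ?rem"
    by (simp add: r_def s_def)
  then have "[:q, p, 1:] dvd [:c0, c1, c2, c3, 1:] \<longleftrightarrow> [:q, p, 1:] dvd ?rem"
    by (metis dvd_add_right_iff dvd_triv_left)
  also have "\<dots> \<longleftrightarrow> ?rem = 0"
  proof
    assume "[:q, p, 1:] dvd ?rem"
    then have "?rem = 0 \<or> degree [:q, p, 1:] \<le> degree ?rem"
      using dvd_imp_degree_le by blast
    moreover have "degree ?rem \<le> 1"
      by (simp add: degree_pCons_eq_if)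
    moreover have "degree [:q, p, 1:] = 2"
      by simp
    ultimately show "?rem = 0" by linarith
  qed simp
  also have "\<dots> \<longleftrightarrow> q * s = c0 \<and> p * s + q * r = c1"
    by auto
  finally show ?thesis .
qed

text \<open>Needed to exclude \<open>a = 0\<close> for factors with \<open>q = 1\<close>.\<close>

lemma rat_square_neq_2: "(p :: rat)\<^sup>2 \<noteq> 2"
proof
  assume "p\<^sup>2 = 2"
  then obtain w where "p = of_int w"
    using rat_sqrt_of_int_is_int[of p 2] by auto
  with \<open>p\<^sup>2 = 2\<close> have "w\<^sup>2 = 2"
    by (metis of_int_eq_iff of_int_numeral of_int_power)
  then have "even w"
    by (metis even_numeral even_power)
  then obtain k where "w = 2 * k" by blast
  then have "2 * k\<^sup>2 = 1" using \<open>w\<^sup>2 = 2\<close> by simp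
  then show False by presburger
qed

text \<open>Divisibility gives two expressions for \<open>a\<close>, equated on the right. The
  condition that \<open>a\<close> is nonzero is then automatic:
  \<open>a = p (1 - q^2) / q = 0\<close> would need \<open>q^2 = -1\<close>, \<open>p^2 = 2\<close>
  or \<open>p^2 = -2\<close>.\<close>

lemma quad_factors_iff:
  "(a, p, q) \<in> quad_factors \<longleftrightarrow>
    q \<noteq> 0 \<and> p * (1 - q\<^sup>2) = q\<^sup>2 + 1 - p\<^sup>2 * q \<and> a = q + 1 / q - p\<^sup>2"
  (is "?L \<longleftrightarrow> ?R")
proof
  assume ?L
  then have qs: "q * (a - q + p\<^sup>2) = 1" and a: "p * (a - q + p\<^sup>2) - q * p = a"
    using quadratic_dvd_quartic_iff[of q p 1 a a 0] by (simp_all add: quad_factors_def power2_eq_square)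
  then have "q \<noteq> 0" by auto
  then have s: "a - q + p\<^sup>2 = 1 / q"
    using qs by (simp only: eq_divide_eq mult.commute) simp
  have aq: "a = q + 1 / q - p\<^sup>2" using s by simp
  have "p * (1 / q) - q * p = q + 1 / q - p\<^sup>2"
    using a unfolding s by (simp only: aq)
  then have "p * (1 - q\<^sup>2) = q\<^sup>2 + 1 - p\<^sup>2 * q"
    using \<open>q \<noteq> 0\<close> by (simp add: field_simps power2_eq_square)
  then show ?R using \<open>q \<noteq> 0\<close> aq by simp
next
  assume R: ?R
  then have q: "q \<noteq> 0" and rel: "p * (1 - q\<^sup>2) = q\<^sup>2 + 1 - p\<^sup>2 * q" and a: "a = q + 1 / q - p\<^sup>2"
    by simp_all
  have s: "a - q + p\<^sup>2 = 1 / q" using a by simp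
  have a': "a = p * (1 / q) - q * p"
    unfolding a using rel q by (simp add: field_simps power2_eq_square)
  have "a \<noteq> 0"
  proof
    assume "a = 0"
    then have "p * (1 - q\<^sup>2) = 0"
      using a' q by (simp add: field_simps power2_eq_square)
    then consider "p = 0" | "q = 1" | "q = -1"
      by (auto simp: power2_eq_1_iff)
    then show False
    proof cases
      case 1
      then have "q\<^sup>2 + 1 = 0" using rel by simp
      then show False by (metis add_nonneg_pos zero_le_power2 zero_less_one less_irrefl)
    next
      case 2
      then show False using rel rat_square_neq_2[of p] by simp
    next
      case 3
      then have "p\<^sup>2 = -2" using rel by simp
      then show False by (metis neg_0_le_iff_le not_numeral_le_zero zero_le_power2)
    qed
  qed
  moreover have "[:q, p, 1:] dvd [:1, a, a, 0, 1:]"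
    using quadratic_dvd_quartic_iff[of q p 1 a a 0] s a' q by (simp add: power2_eq_square mult.commute)
  ultimately show ?L by (simp add: quad_factors_def)
qed

section \<open>Quadratic factors as points of the elliptic curve\<close>

lemma A_set_eq: "A_set = fst ` quad_factors"
  by (force simp: A_set_def quad_factors_def)

text \<open>Here \<open>z = X / 4\<close> and \<open>p (z + 1) = Y / 8\<close>. The relation is
  \<open>p + 1\<close> times the one between \<open>p\<close> and \<open>q\<close>; multiplied by
  \<open>z + 1\<close> it becomes the curve equation.\<close>

lemma quad_factors_scaled:
  assumes "(a, p, q) \<in> quad_factors" and z: "z = q * (p + 1)"
  shows "p\<^sup>2 * (z + 1) = z\<^sup>2 + 1" "z \<noteq> -1"
proof -
  have "p * (1 - q\<^sup>2) = q\<^sup>2 + 1 - p\<^sup>2 * q"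
    using assms(1) by (simp add: quad_factors_iff)
  then show *: "p\<^sup>2 * (z + 1) = z\<^sup>2 + 1"
    unfolding z by algebra
  show "z \<noteq> -1"
    using * by auto
qed

text \<open>The factor \<open>p + 1\<close> has to be cancelled. At \<open>p = -1\<close> the
  original relation reads \<open>q = 2\<close>, which is therefore assumed separately.\<close>

lemma quad_factorsI:
  assumes "q \<noteq> 0" "z = q * (p + 1)" "p\<^sup>2 * (z + 1) = z\<^sup>2 + 1" "p = -1 \<Longrightarrow> q = 2"
  shows "(q + 1 / q - p\<^sup>2, p, q) \<in> quad_factors"
proof -
  have "p * (1 - q\<^sup>2) = q\<^sup>2 + 1 - p\<^sup>2 * q"
  proof (cases "p = -1")
    case False
    have "(p + 1) * (p * (1 - q\<^sup>2) - (q\<^sup>2 + 1 - p\<^sup>2 * q)) = 0"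
      using assms(2,3) by algebra
    then show ?thesis using False by (simp add: add_eq_0_iff)
  qed (use assms(4) in simp)
  then show ?thesis using assms(1) by (simp add: quad_factors_iff)
qed

lemma E1_curve_iff:
  "Affine (4 * z) (8 * y) \<in> ec_points 4 16 64 \<longleftrightarrow> y\<^sup>2 = (z + 1) * (z\<^sup>2 + 1)"
proof -
  have "(8 * y)\<^sup>2 = (4 * z) ^ 3 + 4 * (4 * z)\<^sup>2 + 16 * (4 * z) + 64 \<longleftrightarrow> 64 * y\<^sup>2 = 64 * ((z + 1) * (z\<^sup>2 + 1))"
    by (simp add: algebra_simps power2_eq_square power3_eq_cube)
  then show ?thesis by simp
qed

lemma E1_point_eq: "E1_point (a, p, q) = Affine (4 * (q * (p + 1))) (8 * (p * (q * (p + 1) + 1)))"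
  by (simp add: E1_point_def algebra_simps)

lemma ec_affine_scaled: obtains z y :: rat where "X = 4 * z" "Y = 8 * y"
  by (rule that[of "X / 4" "Y / 8"]) simp_all

text \<open>A point determines \<open>p = y / (z + 1)\<close> and then
  \<open>q = z / (p + 1)\<close>, with \<open>q = 2\<close> if \<open>p = -1\<close>. The affine
  points left out are those with \<open>q = 0\<close>, with \<open>z = -1\<close>, and with
  \<open>p = -1\<close> but \<open>z = 1\<close>.\<close>

lemma bij_betw_E1_point:
  "bij_betw E1_point quad_factors
     (ec_points 4 16 64 - {Infinity, Affine 0 8, Affine (-4) 0, Affine 4 (-16)})"
  (is "bij_betw _ _ ?E")
proof (rule bij_betw_imageI)
  show "inj_on E1_point quad_factors"
  proof (rule inj_onI)
    fix x y
    assume xy: "x \<in> quad_factors" "y \<in> quad_factors" "E1_point x = E1_point y"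
    obtain a p q a' p' q' where x: "x = (a, p, q)" and y: "y = (a', p', q')"
      by (metis surj_pair)
    note A = xy(1,2)[unfolded x y] and eq = xy(3)[unfolded x y]
    define z where "z = q * (p + 1)"
    have "4 * (q * (p + 1)) = 4 * (q' * (p' + 1))"
      and "8 * (p * (q * (p + 1) + 1)) = 8 * (p' * (q' * (p' + 1) + 1))"
      using eq unfolding E1_point_eq ec_point.inject by blast+
    then have e: "q * (p + 1) = q' * (p' + 1)" "p * (q * (p + 1) + 1) = p' * (q' * (p' + 1) + 1)"
      by (metis mult_left_cancel zero_neq_numeral)+
    have z': "z = q' * (p' + 1)"
      unfolding z_def by (rule e(1))
    have "p * (z + 1) = p' * (z + 1)"
      unfolding z_def using e(2) unfolding e(1)[symmetric] .
    then have p: "p = p'"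
      using quad_factors_scaled(2)[OF A(1) z_def] by (simp add: add_eq_0_iff)
    have "q = q'"
    proof (cases "p = -1")
      case True
      then show ?thesis
        using A p by (simp add: quad_factors_iff)
    next
      case False
      then show ?thesis
        using z' p by (simp add: z_def add_eq_0_iff)
    qed
    then show "x = y"
      using A p by (simp add: x y quad_factors_iff)
  qed
  show "E1_point ` quad_factors = ?E"
  proof (intro equalityI subsetI)
    fix P assume "P \<in> E1_point ` quad_factors"
    then obtain a p q where A: "(a, p, q) \<in> quad_factors" and P: "P = E1_point (a, p, q)"
      by auto
    define z where "z = q * (p + 1)"
    have q: "q \<noteq> 0" using A by (simp add: quad_factors_iff)
    have z: "p\<^sup>2 * (z + 1) = z\<^sup>2 + 1" "z \<noteq> -1"
      using quad_factors_scaled[OF A z_def] .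
    have P': "P = Affine (4 * z) (8 * (p * (z + 1)))"
      by (simp add: P E1_point_eq z_def)
    have "(p * (z + 1))\<^sup>2 = (z + 1) * (z\<^sup>2 + 1)"
      using z(1) by algebra
    then have "P \<in> ec_points 4 16 64"
      unfolding P' E1_curve_iff .
    moreover have "P \<noteq> Affine 0 8"
      using q by (auto simp: P' z_def)
    moreover have "P \<noteq> Affine (-4) 0"
      using z(2) by (auto simp: P')
    \<comment> \<open>This point would have \<open>z = 1\<close> and \<open>p = -1\<close>, whereas
      \<open>z = q (p + 1)\<close>.\<close>
    moreover have "P \<noteq> Affine 4 (-16)"
      using z_def by (auto simp: P')
    ultimately show "P \<in> ?E" by (simp add: P')
  next
    fix P assume P: "P \<in> ?E"
    then obtain X Y where "P = Affine X Y" by (cases P) auto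
    then obtain z y where Pzy: "P = Affine (4 * z) (8 * y)" by (metis ec_affine_scaled)
    have y: "y\<^sup>2 = (z + 1) * (z\<^sup>2 + 1)"
      using P unfolding Pzy by (simp add: E1_curve_iff del: ec_points_iff)
    have z: "z + 1 \<noteq> 0"
    proof
      assume "z + 1 = 0"
      then have "y = 0" "z = -1" using y by simp_all
      then show False using P Pzy by simp
    qed
    define p where "p = y / (z + 1)"
    have py: "p * (z + 1) = y" using z by (simp add: p_def)
    have "(z + 1) * (p\<^sup>2 * (z + 1) - (z\<^sup>2 + 1)) = 0"
      using y unfolding py[symmetric] by algebra
    then have pz: "p\<^sup>2 * (z + 1) = z\<^sup>2 + 1" using z by simp
    \<comment> \<open>For \<open>p = -1\<close> the relation leaves \<open>z = 0\<close> or
      \<open>z = 1\<close>, and the latter is an excluded point; otherwise \<open>q\<close> is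
      forced, and \<open>z = 0\<close> would give the excluded point with
      \<open>p = 1\<close>.\<close>
    have "\<exists>q. q \<noteq> 0 \<and> z = q * (p + 1) \<and> (p = -1 \<longrightarrow> q = 2)"
    proof (cases "p = -1")
      case True
      then have "z * (z - 1) = 0" using pz by (simp add: algebra_simps power2_eq_square)
      moreover have "z \<noteq> 1"
        using P Pzy py True by auto
      ultimately show ?thesis using True by auto
    next
      case False
      have "z \<noteq> 0"
      proof
        assume z0: "z = 0"
        then have "p = 1" using pz False by (simp add: power2_eq_1_iff)
        then show False using P Pzy py z0 by simp
      qed
      then show ?thesis
        using False by (intro exI[of _ "z / (p + 1)"]) (simp add: add_eq_0_iff)
    qed
    then obtain q where q: "q \<noteq> 0" "z = q * (p + 1)" "p = -1 \<Longrightarrow> q = 2" by blast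
    have "(q + 1 / q - p\<^sup>2, p, q) \<in> quad_factors"
      using q(1,2) pz q(3) by (rule quad_factorsI)
    moreover have "P = E1_point (q + 1 / q - p\<^sup>2, p, q)"
      unfolding Pzy E1_point_eq q(2)[symmetric] py ..
    ultimately show "P \<in> E1_point ` quad_factors" by blast
  qed
qed

lemma E1_parametrization:
  assumes "Affine X Y \<in> ec_points 4 16 64" "X \<noteq> 4" "Y \<noteq> 2 * X + 8"
  shows "(E1_a X Y, E1_p X Y, E1_q X Y) \<in> quad_factors"
    and "E1_point (E1_a X Y, E1_p X Y, E1_q X Y) = Affine X Y"
proof -
  obtain z y where XY: "X = 4 * z" "Y = 8 * y" by (rule ec_affine_scaled)
  define p q where "p = E1_p X Y" and "q = E1_q X Y"
  have y: "y\<^sup>2 = (z + 1) * (z\<^sup>2 + 1)"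
    using assms(1) unfolding XY by (simp only: E1_curve_iff)
  have nz: "z - 1 \<noteq> 0" "y - z - 1 \<noteq> 0"
    using assms(2,3) by (auto simp: XY)
  have "z + 1 \<noteq> 0"
    using y nz(2) by (auto simp: add_eq_0_iff)
  have q: "q = (y - z - 1) / (z - 1)"
  proof -
    have "q = (8 * (y - z - 1)) / (8 * (z - 1))"
      by (simp add: q_def E1_q_def XY algebra_simps)
    then show ?thesis by (simp only: mult_divide_mult_cancel_left_if) simp
  qed
  have p: "p + 1 = z * (z - 1) / (y - z - 1)"
  proof -
    have "p + 1 = (16 * (z * (z - 1))) / (16 * (y - z - 1))"
      by (simp add: p_def E1_p_def XY algebra_simps)
    then show ?thesis by (simp only: mult_divide_mult_cancel_left_if) simp
  qed
  have q0: "q \<noteq> 0" using q nz by simp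
  have z: "z = q * (p + 1)" unfolding q p using nz by simp
  have "(p + 1) * (y - z - 1) = z * (z - 1)" unfolding p using nz by simp
  \<comment> \<open>The formula for \<open>p\<close> differs from \<open>y / (z + 1)\<close>; the
    two agree modulo the curve equation.\<close>
  then have "(y - z - 1) * (p * (z + 1) - y) = 0"
    using y by algebra
  then have py: "p * (z + 1) = y" using nz by simp
  have "(z + 1) * (p\<^sup>2 * (z + 1) - (z\<^sup>2 + 1)) = 0"
    using y unfolding py[symmetric] by algebra
  then have pz: "p\<^sup>2 * (z + 1) = z\<^sup>2 + 1" using \<open>z + 1 \<noteq> 0\<close> by simp
  have "q = 2" if "p = -1"
  proof -
    have "z = 0" using z that by simp
    then show ?thesis using q py that by simp
  qed
  then have "(q + 1 / q - p\<^sup>2, p, q) \<in> quad_factors"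
    using q0 z pz by (intro quad_factorsI)
  then show "(E1_a X Y, E1_p X Y, E1_q X Y) \<in> quad_factors"
    by (simp add: E1_a_def p_def q_def)
  show "E1_point (E1_a X Y, E1_p X Y, E1_q X Y) = Affine X Y"
    unfolding p_def[symmetric] q_def[symmetric] E1_point_eq z[symmetric] py by (simp add: XY)
qed

text \<open>The rational formulas miss just one point in the image of \<open>E1_point\<close>,
  namely \<open>(4, 16)\<close>. Its value \<open>a = 3/2\<close> is also attained at
  \<open>(0, -8)\<close>, where they apply.\<close>

lemma A_set_parametrized:
  "A_set = {E1_a X Y | X Y. Affine X Y \<in> ec_points 4 16 64 \<and> X \<noteq> 4 \<and> Y \<noteq> 2 * X + 8}"
  (is "_ = ?R")
proof (intro equalityI subsetI)
  fix a assume "a \<in> A_set"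
  then obtain p q where A: "(a, p, q) \<in> quad_factors" by (force simp: A_set_eq)
  have inj: "inj_on E1_point quad_factors"
    using bij_betw_E1_point by (rule bij_betw_imp_inj_on)
  obtain X Y where XY: "E1_point (a, p, q) = Affine X Y" by (simp add: E1_point_eq)
  then have E: "Affine X Y \<in> ec_points 4 16 64 - {Infinity, Affine 0 8, Affine (-4) 0, Affine 4 (-16)}"
    using bij_betw_apply[OF bij_betw_E1_point A] by simp
  show "a \<in> ?R"
  proof (cases "X \<noteq> 4 \<and> Y \<noteq> 2 * X + 8")
    case True
    then have "(a, p, q) = (E1_a X Y, E1_p X Y, E1_q X Y)"
      using E E1_parametrization[of X Y] A XY by (intro inj_onD[OF inj]) (simp_all del: ec_points_iff)
    then show ?thesis using E True by blast
  next
    case False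
    have curve: "Y\<^sup>2 = X ^ 3 + 4 * X\<^sup>2 + 16 * X + 64" using E by simp
    have X: "X = 4"
    proof (rule ccontr)
      assume "X \<noteq> 4"
      then have Y: "Y = 2 * X + 8" using False by simp
      \<comment> \<open>The line \<open>Y = 2 X + 8\<close> meets the curve exactly over
        \<open>X = -4\<close>, \<open>0\<close> and \<open>4\<close>.\<close>
      have "(X + 4) * (X * (X - 4)) = 0"
        using curve unfolding Y by algebra
      then have "X = -4 \<or> X = 0" using \<open>X \<noteq> 4\<close> by (auto simp: add_eq_0_iff)
      then show False using E Y by auto
    qed
    then have "Y\<^sup>2 = 16\<^sup>2" using curve by simp
    then have "Y = 16 \<or> Y = -16" by (simp only: power2_eq_iff)
    then have Y: "Y = 16" using E X by auto
    \<comment> \<open>The quartic for \<open>a = 3/2\<close> is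
      \<open>(x^2 + x + 1/2) (x^2 - x + 2)\<close>; the first factor lies over
      \<open>(4, 16)\<close>, the second over \<open>(0, -8)\<close>.\<close>
    have "(3 / 2, 1, 1 / 2) \<in> quad_factors"
      by (simp add: quad_factors_iff field_simps power2_eq_square)
    moreover have "E1_point (3 / 2, 1, 1 / 2) = Affine X Y"
      by (simp add: E1_point_eq X Y)
    ultimately have "(a, p, q) = (3 / 2, 1, 1 / 2)"
      using A XY by (intro inj_onD[OF inj]) simp_all
    then have "a = E1_a 0 (-8)"
      by (simp add: E1_a_def E1_p_def E1_q_def)
    then show ?thesis by force
  qed
qed (use E1_parametrization(1) in \<open>force simp: A_set_eq\<close>)

text \<open>
  For fixed \<open>a\<close> the relations \<open>p (1 - q\<^sup>2) = a q\<close> and \<open>p\<^sup>2 = q + 1/q - a\<close> determine \<open>p\<close> from \<open>q\<close>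
  and make \<open>q\<close> a root of a nonzero polynomial.
\<close>

lemma finite_quad_factors_fibre: "finite {x \<in> quad_factors. fst x = a}"
proof -
  \<comment> \<open>The result of eliminating \<open>p\<close> from the two relations; the constant
    term 1 shows that it is nonzero.\<close>
  let ?f = "[:1, - a, -1, 2 * a - a\<^sup>2, -1, - a, 1:]"
  have "{x \<in> quad_factors. fst x = a} \<subseteq> (\<lambda>q. (a, a * q / (1 - q\<^sup>2), q)) ` {q. poly ?f q = 0}"
  proof
    fix x assume "x \<in> {x \<in> quad_factors. fst x = a}"
    then obtain p q where x: "x = (a, p, q)" and A: "(a, p, q) \<in> quad_factors"
      by (cases x) auto
    then have q: "q \<noteq> 0" and rel: "p * (1 - q\<^sup>2) = q\<^sup>2 + 1 - p\<^sup>2 * q" and a: "a = q + 1 / q - p\<^sup>2"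
      by (simp_all add: quad_factors_iff)
    have aq: "a * q = q\<^sup>2 + 1 - p\<^sup>2 * q"
      unfolding a using q by (simp add: field_simps power2_eq_square)
    have pq: "p * (1 - q\<^sup>2) = a * q" using rel aq by simp
    have "1 - q\<^sup>2 \<noteq> 0"
    proof
      assume "1 - q\<^sup>2 = 0"
      then have "a * q = 0" using pq by simp
      moreover have "a \<noteq> 0" using A by (simp add: quad_factors_def)
      ultimately show False using q by simp
    qed
    then have p: "p = a * q / (1 - q\<^sup>2)"
      using pq by (simp add: field_simps)
    have "poly ?f q = (1 - q\<^sup>2)\<^sup>2 * (q\<^sup>2 + 1 - a * q) - (a * q)\<^sup>2 * q"
      by (simp add: algebra_simps power2_eq_square)
    also have "\<dots> = 0"
      using pq aq by algebra
    finally show "x \<in> (\<lambda>q. (a, a * q / (1 - q\<^sup>2), q)) ` {q. poly ?f q = 0}"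
      using x p by blast
  qed
  moreover have "finite {q. poly ?f q = 0}"
    by (rule poly_roots_finite) simp
  ultimately show ?thesis
    by (meson finite_imageI finite_subset)
qed

text \<open>Each \<open>a\<close> has finitely many factors, so a finite \<open>A_set\<close> would
  leave only finitely many rational points on the curve.\<close>

lemma infinite_A_set: "infinite A_set"
proof
  assume "finite A_set"
  then have "finite (\<Union>a\<in>A_set. {x \<in> quad_factors. fst x = a})"
    using finite_quad_factors_fibre by blast
  moreover have "quad_factors \<subseteq> (\<Union>a\<in>A_set. {x \<in> quad_factors. fst x = a})"
    by (auto simp: A_set_eq)
  ultimately have "finite quad_factors" by (rule rev_finite_subset)
  then have "finite (ec_points 4 16 64 - {Infinity, Affine 0 8, Affine (-4) 0, Affine 4 (-16)})"
    using bij_betw_E1_point bij_betw_finite by blast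
  then show False using ec_points_infinite by simp
qed

section \<open>The quartic \<open>x^4 + a x^3 + a x + 1\<close>\<close>

lemma dvd_palindromic_quartic_iff:
  fixes a p q :: rat
  shows "[:q, p, 1:] dvd [:1, a, 0, a, 1:] \<longleftrightarrow> p \<noteq> 0 \<and> q = 1 \<and> a = (p\<^sup>2 - 2) / p"
proof -
  define s where "s = - q - p * (a - p)"
  have "[:q, p, 1:] dvd [:1, a, 0, a, 1:] \<longleftrightarrow> q * s = 1 \<and> p * s + q * (a - p) = a"
    using quadratic_dvd_quartic_iff[of q p 1 a 0 a] by (simp add: s_def)
  also have "\<dots> \<longleftrightarrow> p \<noteq> 0 \<and> q = 1 \<and> a = (p\<^sup>2 - 2) / p"
  proof
    assume R: "q * s = 1 \<and> p * s + q * (a - p) = a"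
    have "q = 1"
    proof (rule ccontr)
      assume "q \<noteq> 1"
      \<comment> \<open>Obtained by multiplying the second equation by \<open>q\<close> and using
        \<open>q s = 1\<close>. If the other factor vanishes, \<open>q s = 1\<close> becomes a
        vanishing sum of squares.\<close>
      have "(1 - q) * (a * q - p * (1 + q)) = 0"
        using R by algebra
      then have "a * q = p * (1 + q)" using \<open>q \<noteq> 1\<close> by simp
      then have "1 + q\<^sup>2 + p\<^sup>2 = 0"
        using R unfolding s_def by algebra
      then show False
        by (metis add_nonneg_pos add_pos_nonneg less_irrefl zero_le_power2 zero_less_one)
    qed
    then have "p * a = p\<^sup>2 - 2" using R by (simp add: s_def algebra_simps power2_eq_square)
    moreover from this have "p \<noteq> 0" by auto
    ultimately show "p \<noteq> 0 \<and> q = 1 \<and> a = (p\<^sup>2 - 2) / p"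
      using \<open>q = 1\<close> by (simp add: field_simps)
  next
    assume R: "p \<noteq> 0 \<and> q = 1 \<and> a = (p\<^sup>2 - 2) / p"
    then have "p * a = p\<^sup>2 - 2" by simp
    then have "s = 1" using R by (simp add: s_def algebra_simps power2_eq_square)
    then show "q * s = 1 \<and> p * s + q * (a - p) = a" using R by simp
  qed
  finally show ?thesis .
qed

theorem theorem2p4:
  shows
    "(infinite A_set
      \<and> bij_betw E1_point quad_factors
          (ec_points 4 16 64 - {Infinity, Affine 0 8, Affine (-4) 0, Affine 4 (-16)})
      \<and> (\<forall>X Y. Affine X Y \<in> ec_points 4 16 64 \<and> X \<noteq> 4 \<and> Y \<noteq> 2 * X + 8 \<longrightarrow>
            (E1_a X Y, E1_p X Y, E1_q X Y) \<in> quad_factors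
            \<and> E1_point (E1_a X Y, E1_p X Y, E1_q X Y) = Affine X Y)
      \<and> A_set = {E1_a X Y | X Y. Affine X Y \<in> ec_points 4 16 64 \<and> X \<noteq> 4 \<and> Y \<noteq> 2 * X + 8}
      \<and> is_elliptic_curve 4 16 64
      \<and> has_rank (ec_group 4 16 64) 1)
     \<and>
     (\<forall>a p q :: rat. a \<noteq> 0 \<and> p\<^sup>2 + q\<^sup>2 \<noteq> 0 \<longrightarrow>
        ([:q, p, 1:] dvd [:1, a, 0, a, 1:] \<longleftrightarrow> p \<noteq> 0 \<and> q = 1 \<and> a = (p\<^sup>2 - 2) / p)
        \<and> ([:q, p, 1:] dvd [:1, a, 0, a, 1:] \<longrightarrow>
             [:1, (p\<^sup>2 - 2) / p, 0, (p\<^sup>2 - 2) / p, 1:] = [:1, p, 1:] * [:1, - (2 / p), 1:]))"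
proof (intro conjI allI impI)
  show "infinite A_set"
    by (rule infinite_A_set)
  show "bij_betw E1_point quad_factors
      (ec_points 4 16 64 - {Infinity, Affine 0 8, Affine (-4) 0, Affine 4 (-16)})"
    by (rule bij_betw_E1_point)
  show "A_set = {E1_a X Y | X Y. Affine X Y \<in> ec_points 4 16 64 \<and> X \<noteq> 4 \<and> Y \<noteq> 2 * X + 8}"
    by (rule A_set_parametrized)
  show "is_elliptic_curve 4 16 64"
    by (simp add: is_elliptic_curve_def)
  show "has_rank (ec_group 4 16 64) 1"
    by (rule ec_group_rank)
next
  fix X Y
  assume "Affine X Y \<in> ec_points 4 16 64 \<and> X \<noteq> 4 \<and> Y \<noteq> 2 * X + 8"
  then show "(E1_a X Y, E1_p X Y, E1_q X Y) \<in> quad_factors"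
    and "E1_point (E1_a X Y, E1_p X Y, E1_q X Y) = Affine X Y"
    using E1_parametrization by blast+
next
  fix a p q :: rat
  show "[:q, p, 1:] dvd [:1, a, 0, a, 1:] \<longleftrightarrow> p \<noteq> 0 \<and> q = 1 \<and> a = (p\<^sup>2 - 2) / p"
    by (rule dvd_palindromic_quartic_iff)
  assume "[:q, p, 1:] dvd [:1, a, 0, a, 1:]"
  then show "[:1, (p\<^sup>2 - 2) / p, 0, (p\<^sup>2 - 2) / p, 1:] = [:1, p, 1:] * [:1, - (2 / p), 1:]"
    by (simp add: dvd_palindromic_quartic_iff field_simps power2_eq_square)
qed

end
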